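(* Let $x_{1}=f(x,u)$ be a sampled data system with $n$-dimensional state $x$ and $m$-dimensional input $u$, where $f$ is a surjective submersion and $\operatorname{rank}(\partial_u f)=m$. Let $U=\operatorname{span}\{\partial_{u^1},\dots,\partial_{u^m}\}\subset\mathcal T(\mathcal E)$ and let $K$ be the distribution on $\mathcal E$ of all vector fields $v$ with $v(f^i)=0$, $i=1,\dots,n$. The condition $$[U,K]\subseteq U\oplus K$$ is necessary and locally sufficient for the system to be transformable to the form $$\begin{array}{rcl}\tilde x_{a,1}&=&\tilde f_a(\tilde x_a,\tilde x_b)\\ \tilde x_{b,1}&=&\tilde u\end{array}$$ with $\dim\tilde x_a=n-m$ and $\dim\tilde x_b=\dim\tilde u=m$.
   Context: All objects are smooth and all considerations are local; all distributions have constant rank near the points considered. System: $\mathcal X$ is the $n$-dimensional state manifold with coordinates $x$, $\mathcal E\to\mathcal X$ a bundle with coordinates $(x,u)$, $\dim u=m$, and $f:\mathcal E\to\mathcal X_1$ (a copy of $\mathcal X$ with coordinates $x_1$). The subscript $1$ denotes the forward time shift. The condition $\operatorname{rank}(\partial_u f)=m$ says there are no redundant inputs. Transformability: a system is transformable to a given form if there are local diffeomorphisms $\tilde x=\varphi_x(x)$ (used also at the shifted point, $\tilde x_1=\varphi_x(x_1)$) and $(x,u)\mapsto(\varphi_x(x),\varphi_u(x,u))$, with new input $\tilde u=\varphi_u(x,u)$, which bring the system equations to that form. $[U,K]$ denotes the span of all Lie brackets of vector fields in $U$ with vector fields in $K$. *)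

theory Defs
  imports "HOL-Analysis.Analysis"
begin

text \<open>
  All objects are given in local coordinates: the state manifold is an open set
  \<open>X\<close> of \<open>real^'n\<close>, the bundle an open set \<open>E\<close> of \<open>(real^'n) \<times> (real^'m)\<close> with
  \<open>fst ` E = X\<close>, and the projection \<open>fst\<close> forgets the input.
\<close>

primrec Ck_on :: "nat \<Rightarrow> 'a::euclidean_space set \<Rightarrow> ('a \<Rightarrow> 'b::real_normed_vector) \<Rightarrow> bool" where
  "Ck_on 0 S f \<longleftrightarrow> continuous_on S f"
| "Ck_on (Suc k) S f \<longleftrightarrow> (\<forall>x\<in>S. f differentiable (at x)) \<and>
     (\<forall>v. Ck_on k S (\<lambda>x. frechet_derivative f (at x) v))"

text \<open>Only meaningful for open \<open>S\<close>, since derivatives are taken in the full neighbourhood filter.\<close>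

definition smooth_on :: "'a::euclidean_space set \<Rightarrow> ('a \<Rightarrow> 'b::real_normed_vector) \<Rightarrow> bool" where
  "smooth_on S f \<longleftrightarrow> (\<forall>k. Ck_on k S f)"

definition diffeo_on :: "'a::euclidean_space set \<Rightarrow> ('a \<Rightarrow> 'b::euclidean_space) \<Rightarrow> bool" where
  "diffeo_on S \<phi> \<longleftrightarrow> open S \<and> open (\<phi> ` S) \<and> smooth_on S \<phi> \<and>
     (\<exists>\<psi>. smooth_on (\<phi> ` S) \<psi> \<and> (\<forall>x\<in>S. \<psi> (\<phi> x) = x))"

text \<open>A distribution assigns a subspace to every point; \<open>sections D \<Delta>\<close> are its vector fields on \<open>D\<close>.\<close>

type_synonym 'a distribution = "'a \<Rightarrow> 'a set"

definition sections :: "'a::euclidean_space set \<Rightarrow> 'a distribution \<Rightarrow> ('a \<Rightarrow> 'a) set" where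
  "sections D \<Delta> = {v. smooth_on D v \<and> (\<forall>p\<in>D. v p \<in> \<Delta> p)}"

definition lie_bracket :: "('a::euclidean_space \<Rightarrow> 'a) \<Rightarrow> ('a \<Rightarrow> 'a) \<Rightarrow> 'a \<Rightarrow> 'a" where
  "lie_bracket v w p = frechet_derivative w (at p) (v p) - frechet_derivative v (at p) (w p)"

definition bracket_dist ::
    "'a::euclidean_space set \<Rightarrow> 'a distribution \<Rightarrow> 'a distribution \<Rightarrow> 'a distribution" where
  "bracket_dist D \<Delta>\<^sub>1 \<Delta>\<^sub>2 p =
     span {lie_bracket v w p | v w. v \<in> sections D \<Delta>\<^sub>1 \<and> w \<in> sections D \<Delta>\<^sub>2}"

definition sum_dist ::
    "'a::euclidean_space distribution \<Rightarrow> 'a distribution \<Rightarrow> 'a distribution" where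
  "sum_dist \<Delta>\<^sub>1 \<Delta>\<^sub>2 p = {a + b | a b. a \<in> \<Delta>\<^sub>1 p \<and> b \<in> \<Delta>\<^sub>2 p}"

definition input_dist :: "((real^'n) \<times> (real^'m)) distribution" where
  "input_dist p = span (range (\<lambda>j. (0, axis j 1)))"

definition kernel_dist ::
    "((real^'n) \<times> (real^'m) \<Rightarrow> real^'n) \<Rightarrow> ((real^'n) \<times> (real^'m)) distribution" where
  "kernel_dist f p = {v. \<forall>i. frechet_derivative (\<lambda>q. f q $ i) (at p) v = 0}"

definition bracket_condition ::
    "((real^'n) \<times> (real^'m)) set \<Rightarrow> ((real^'n) \<times> (real^'m) \<Rightarrow> real^'n) \<Rightarrow> bool" where
  "bracket_condition D f \<longleftrightarrow>
     (\<forall>p\<in>D. bracket_dist D input_dist (kernel_dist f) p \<subseteq> sum_dist input_dist (kernel_dist f) p)"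

text \<open>
  \<open>transformable_on X D f F\<close>: the system \<open>f\<close>, restricted to \<open>D\<close>, is brought by
  \<open>\<phi>\<^sub>x\<close> and \<open>\<phi>\<^sub>u\<close> to a system \<open>g\<close> on the image of \<open>D\<close> which has the form \<open>F\<close>.
  The domain \<open>W\<close> of \<open>\<phi>\<^sub>x\<close> contains both the states \<open>x\<close> and the shifted states \<open>f (x, u)\<close>,
  because the same \<open>\<phi>\<^sub>x\<close> is applied to both.
\<close>

definition transformable_on ::
    "(real^'n) set \<Rightarrow> ((real^'n) \<times> (real^'m)) set \<Rightarrow> ((real^'n) \<times> (real^'m) \<Rightarrow> real^'n) \<Rightarrow>
     (((real^'n) \<times> (real^'m)) set \<Rightarrow> ((real^'n) \<times> (real^'m) \<Rightarrow> real^'n) \<Rightarrow> bool) \<Rightarrow> bool" where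
  "transformable_on X D f F \<longleftrightarrow>
     (\<exists>W \<phi>\<^sub>x \<phi>\<^sub>u g.
        W \<subseteq> X \<and> fst ` D \<subseteq> W \<and> f ` D \<subseteq> W \<and>
        diffeo_on W \<phi>\<^sub>x \<and>
        diffeo_on D (\<lambda>(x, u). (\<phi>\<^sub>x x, \<phi>\<^sub>u (x, u))) \<and>
        (\<forall>(x, u)\<in>D. \<phi>\<^sub>x (f (x, u)) = g (\<phi>\<^sub>x x, \<phi>\<^sub>u (x, u))) \<and>
        F ((\<lambda>(x, u). (\<phi>\<^sub>x x, \<phi>\<^sub>u (x, u))) ` D) g)"

text \<open>
  The state splits as \<open>x = (x\<^sub>a, x\<^sub>b)\<close>, where \<open>x\<^sub>b\<close> consists of the \<open>m\<close> components with index
  in \<open>range \<beta>\<close> and \<open>x\<^sub>a\<close> of the remaining \<open>n - m\<close> components. An injection is used rather than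
  a product type, so that \<open>n = m\<close> (no \<open>x\<^sub>a\<close>) is included.
\<close>

definition decomposed_form ::
    "((real^'n) \<times> (real^'m)) set \<Rightarrow> ((real^'n) \<times> (real^'m) \<Rightarrow> real^'n) \<Rightarrow> bool" where
  "decomposed_form D g \<longleftrightarrow>
     (\<exists>(\<beta> :: 'm \<Rightarrow> 'n) (f\<^sub>a :: 'n \<Rightarrow> real^'n \<Rightarrow> real).
        inj \<beta> \<and>
        (\<forall>i. i \<notin> range \<beta> \<longrightarrow> smooth_on (fst ` D) (f\<^sub>a i)) \<and>
        (\<forall>(x, u)\<in>D. (\<forall>i. i \<notin> range \<beta> \<longrightarrow> g (x, u) $ i = f\<^sub>a i x) \<and>
                     (\<forall>j. g (x, u) $ \<beta> j = u $ j)))"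

end

theory Submission
  imports Defs
begin

text \<open>
  Necessity: the functions \<open>\<phi>\<^sub>a \<circ> f\<close>, which depend on \<open>x\<close> only, are annihilated by \<open>U\<close> and by \<open>K\<close>, hence
  by \<open>[U, K]\<close>, and the common annihilator of their differentials is \<open>U \<oplus> K\<close>.

  Sufficiency needs no Frobenius theorem. If \<open>k\<close> is a field in \<open>K\<close>, differentiating \<open>df(k) = 0\<close> shows that
  \<open>[U, K] \<subseteq> U \<oplus> K\<close> says: the derivative of \<open>\<partial>\<^sub>u f\<close> along the fibres of \<open>f\<close> stays in the image of \<open>\<partial>\<^sub>u f\<close>.
  Normalising a square block of \<open>\<partial>\<^sub>u f\<close> to the identity turns this into a vanishing derivative, so that image
  depends on \<open>f(x, u)\<close> alone. It therefore defines a distribution on the shifted state space, and the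
  integral manifolds of this distribution are already at hand: they are the orbits \<open>u \<mapsto> f(x, u)\<close>.
  Letting \<open>x\<close> run through a transversal gives coordinates \<open>(x\<^sub>a, x\<^sub>b)\<close> near \<open>f(x\<^sub>0, u\<^sub>0)\<close>, with \<open>x\<^sub>a\<close>
  labelling the orbits. If \<open>x\<^sub>0\<close> lies outside their domain, \<open>\<phi>\<^sub>x\<close> is a translation near \<open>x\<^sub>0\<close>.
\<close>

section \<open>Calculus of \<open>C\<^sup>k\<close> maps\<close>

lemma Ck_on_cong:
  assumes "open S" "\<And>x. x \<in> S \<Longrightarrow> f x = g x" "Ck_on k S f"
  shows "Ck_on k S g"
  using assms(2,3)
proof (induction k arbitrary: f g)
  case 0
  then show ?case by (metis Ck_on.simps(1) continuous_on_cong)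
next
  case (Suc k)
  have der: "(g has_derivative frechet_derivative f (at x)) (at x)" if "x \<in> S" for x
  proof (rule has_derivative_transform_within_open[OF _ \<open>open S\<close> that])
    show "(f has_derivative frechet_derivative f (at x)) (at x)"
      using Suc.prems(2) that by (simp add: frechet_derivative_works[symmetric])
  qed (use Suc.prems(1) in auto)
  then have "frechet_derivative f (at x) v = frechet_derivative g (at x) v" if "x \<in> S" for x v
    using frechet_derivative_at that by metis
  then have "Ck_on k S (\<lambda>x. frechet_derivative g (at x) v)" for v
    using Suc.IH[of "\<lambda>x. frechet_derivative f (at x) v" "\<lambda>x. frechet_derivative g (at x) v"]
      Suc.prems(2) by auto
  with der show ?case by (auto simp: differentiable_def)
qed

text \<open>The definition tests the chosen function \<open>frechet_derivative\<close>. On an open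
  set any explicit derivative may stand in for it, so the rules below only have to exhibit a
  formula.\<close>

lemma Ck_on_SucI:
  assumes "open S" "\<And>x. x \<in> S \<Longrightarrow> (f has_derivative f' x) (at x)"
    and "\<And>v. Ck_on k S (\<lambda>x. f' x v)"
  shows "Ck_on (Suc k) S f"
proof -
  have "Ck_on k S (\<lambda>x. frechet_derivative f (at x) v)" for v
    by (rule Ck_on_cong[OF assms(1) _ assms(3)[of v]]) (use assms(2) frechet_derivative_at in metis)
  then show ?thesis using assms(2) by (auto simp: differentiable_def)
qed

lemma Ck_on_SucD: "Ck_on (Suc k) S f \<Longrightarrow> Ck_on k S f"
proof (induction k arbitrary: f)
  case 0
  then show ?case
    by (auto intro!: continuous_at_imp_continuous_on differentiable_imp_continuous_within)
qed auto

lemma Ck_on_continuous: "Ck_on k S f \<Longrightarrow> continuous_on S f"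
  by (induction k) (auto dest: Ck_on_SucD simp del: Ck_on.simps(2))

lemma Ck_on_subset: "Ck_on k S f \<Longrightarrow> T \<subseteq> S \<Longrightarrow> Ck_on k T f"
  by (induction k arbitrary: f) (auto intro: continuous_on_subset)

lemma Ck_on_Un:
  "open S \<Longrightarrow> open T \<Longrightarrow> Ck_on k S f \<Longrightarrow> Ck_on k T f \<Longrightarrow> Ck_on k (S \<union> T) f"
  by (induction k arbitrary: f) (auto intro: continuous_on_open_Un)

lemma Ck_on_const: "open S \<Longrightarrow> Ck_on k S (\<lambda>x. c)"
  by (induction k arbitrary: c) auto

lemma Ck_on_bounded_linear_compose:
  assumes "open S" "bounded_linear L" "Ck_on k S f"
  shows "Ck_on k S (\<lambda>x. L (f x))"
  using assms(3)
proof (induction k arbitrary: f)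
  case 0
  then show ?case using assms(2) by (auto intro: bounded_linear.continuous_on)
next
  case (Suc k)
  show ?case
    by (rule Ck_on_SucI[where f' = "\<lambda>x v. L (frechet_derivative f (at x) v)", OF \<open>open S\<close>])
      (use Suc in \<open>auto intro!: bounded_linear.has_derivative[OF assms(2)]
        simp: frechet_derivative_works[symmetric]\<close>)
qed

lemma Ck_on_id: "open S \<Longrightarrow> Ck_on k S (\<lambda>x. x)"
  by (induction k) (auto simp: Ck_on_const)

lemma Ck_on_add:
  assumes "open S" "Ck_on k S f" "Ck_on k S g"
  shows "Ck_on k S (\<lambda>x. f x + g x)"
  using assms(2,3)
proof (induction k arbitrary: f g)
  case 0
  then show ?case by (auto intro: continuous_intros)
next
  case (Suc k)
  show ?case
    by (rule Ck_on_SucI[where f' = "\<lambda>x v. frechet_derivative f (at x) v + frechet_derivative g (at x) v",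
          OF \<open>open S\<close>])
      (use Suc in \<open>auto intro!: has_derivative_add simp: frechet_derivative_works[symmetric]\<close>)
qed

lemma Ck_on_sum:
  assumes "open S" "\<And>i. i \<in> I \<Longrightarrow> Ck_on k S (f i)"
  shows "Ck_on k S (\<lambda>x. \<Sum>i\<in>I. f i x)"
  using assms(2)
  by (induction I rule: infinite_finite_induct) (auto intro: Ck_on_add Ck_on_const assms(1))

lemma Ck_on_bilinear:
  assumes "open S" "bounded_bilinear B" "Ck_on k S f" "Ck_on k S g"
  shows "Ck_on k S (\<lambda>x. B (f x) (g x))"
  using assms(3,4)
proof (induction k arbitrary: f g)
  case 0
  then show ?case by (auto intro: bounded_bilinear.continuous_on[OF assms(2)])
next
  case (Suc k)
  have "Ck_on k S f" "Ck_on k S g" using Suc.prems Ck_on_SucD by blast+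
  then show ?case
    by (intro Ck_on_SucI[where f' = "\<lambda>x v. B (f x) (frechet_derivative g (at x) v)
          + B (frechet_derivative f (at x) v) (g x)", OF \<open>open S\<close>] Ck_on_add[OF \<open>open S\<close>] Suc.IH)
      (use Suc in \<open>auto intro!: bounded_bilinear.FDERIV[OF assms(2)]
        simp: frechet_derivative_works[symmetric]\<close>)
qed

section \<open>Linear maps depending on a point, the chain rule, inversion\<close>

lemma linear_basis_expansion:
  fixes L :: "'a::euclidean_space \<Rightarrow> 'b::real_vector"
  assumes "linear L"
  shows "L v = (\<Sum>b\<in>Basis. (v \<bullet> b) *\<^sub>R L b)"
proof -
  have "L v = L (\<Sum>b\<in>Basis. (v \<bullet> b) *\<^sub>R b)" by (simp add: euclidean_representation)
  then show ?thesis by (simp only: linear_sum[OF assms] linear_cmul[OF assms])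
qed

text \<open>Regularity of the family is known only for each fixed argument. Expanding the moving
  argument \<open>w x\<close> in the basis leaves a finite sum of scalar coefficients times
  \<open>B x b\<close>.\<close>

lemma Ck_on_linear_family_apply:
  fixes B :: "'a::euclidean_space \<Rightarrow> 'b::euclidean_space \<Rightarrow> 'c::real_normed_vector"
  assumes "open S" "\<And>x. x \<in> S \<Longrightarrow> linear (B x)"
    and "\<And>v. Ck_on k S (\<lambda>x. B x v)" "Ck_on k S w"
  shows "Ck_on k S (\<lambda>x. B x (w x))"
proof (rule Ck_on_cong[OF \<open>open S\<close>])
  show "(\<Sum>b\<in>Basis. (w x \<bullet> b) *\<^sub>R B x b) = B x (w x)" if "x \<in> S" for x
    using linear_basis_expansion[OF assms(2)[OF that]] by metis
  show "Ck_on k S (\<lambda>x. \<Sum>b\<in>Basis. (w x \<bullet> b) *\<^sub>R B x b)"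
    by (intro Ck_on_sum Ck_on_bilinear[OF _ bounded_bilinear_scaleR] assms
        Ck_on_bounded_linear_compose[OF _ bounded_linear_inner_left])
qed

text \<open>By the chain rule the derivative is a linear family, the derivative of \<open>g\<close>
  at \<open>f x\<close>, applied to a moving vector. The induction keeps \<open>g\<close> arbitrary
  because its hypothesis is used for the directional derivatives of \<open>g\<close>.\<close>

lemma Ck_on_compose:
  fixes f :: "'a::euclidean_space \<Rightarrow> 'b::euclidean_space" and g :: "'b \<Rightarrow> 'c::real_normed_vector"
  assumes "open S" "open T" "f ` S \<subseteq> T" "Ck_on k S f" "Ck_on k T g"
  shows "Ck_on k S (\<lambda>x. g (f x))"
  using assms(4,5)
proof (induction k arbitrary: g)
  case 0
  then show ?case using assms(3) by (auto intro: continuous_on_compose2)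
next
  case (Suc k)
  have fS: "f x \<in> T" if "x \<in> S" for x using that assms(3) by auto
  have f: "Ck_on k S f" using Suc.prems Ck_on_SucD by blast
  show ?case
  proof (rule Ck_on_SucI[where f' = "\<lambda>x v. frechet_derivative g (at (f x)) (frechet_derivative f (at x) v)",
        OF \<open>open S\<close>])
    fix x assume "x \<in> S"
    then show "((\<lambda>x. g (f x)) has_derivative
        (\<lambda>v. frechet_derivative g (at (f x)) (frechet_derivative f (at x) v))) (at x)"
      using Suc.prems fS diff_chain_at[of f _ x g]
      by (auto simp: frechet_derivative_works o_def)
  next
    fix v
    show "Ck_on k S (\<lambda>x. frechet_derivative g (at (f x)) (frechet_derivative f (at x) v))"
      by (rule Ck_on_linear_family_apply[OF \<open>open S\<close>])
        (use Suc.IH[OF f, of "\<lambda>y. frechet_derivative g (at y) w" for w] Suc.prems fS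
          in \<open>auto intro!: linear_frechet_derivative\<close>)
  qed
qed

text \<open>At a zero of \<open>u\<close> the term of the product rule that carries the derivative
  of \<open>G\<close> drops out, so continuity of \<open>G\<close> suffices. This serves for
  families of inverses, whose continuity is established before their differentiability.\<close>

lemma has_derivative_scaleR_vanishing:
  fixes u :: "'a::real_normed_vector \<Rightarrow> real" and G :: "'a \<Rightarrow> 'b::real_normed_vector"
  assumes u: "(u has_derivative u') (at x)" "u x = 0" and G: "isCont G x"
  shows "((\<lambda>y. u y *\<^sub>R G y) has_derivative (\<lambda>h. u' h *\<^sub>R G x)) (at x)"
proof -
  interpret u': bounded_linear u' using u(1) by (rule has_derivative_bounded_linear)
  obtain K where K: "\<And>h. norm (u' h) \<le> norm h * K" "K \<ge> 0" using u'.nonneg_bounded by blast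
  have 1: "((\<lambda>y. norm (u y - u x - u' (y - x)) / norm (y - x) * norm (G y) + K * norm (G y - G x))
      \<longlongrightarrow> 0) (at x)"
  proof -
    have "((\<lambda>y. norm (u y - u x - u' (y - x)) / norm (y - x) * norm (G y) + K * norm (G y - G x))
      \<longlongrightarrow> 0 * norm (G x) + K * norm (G x - G x)) (at x)"
      using u(1) G unfolding has_derivative_iff_norm isCont_def by (intro tendsto_intros) auto
    then show ?thesis by (simp only: mult_zero_left diff_self norm_zero mult_zero_right add_0)
  qed
  have "((\<lambda>y. norm (u y *\<^sub>R G y - u x *\<^sub>R G x - u' (y - x) *\<^sub>R G x) / norm (y - x)) \<longlongrightarrow> 0) (at x)"
  proof (rule tendsto_sandwich[of "\<lambda>_. 0", OF _ _ tendsto_const 1])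
    show "\<forall>\<^sub>F y in at x. norm (u y *\<^sub>R G y - u x *\<^sub>R G x - u' (y - x) *\<^sub>R G x) / norm (y - x)
      \<le> norm (u y - u x - u' (y - x)) / norm (y - x) * norm (G y) + K * norm (G y - G x)"
    proof (rule always_eventually, rule allI)
      fix y
      show "norm (u y *\<^sub>R G y - u x *\<^sub>R G x - u' (y - x) *\<^sub>R G x) / norm (y - x)
        \<le> norm (u y - u x - u' (y - x)) / norm (y - x) * norm (G y) + K * norm (G y - G x)"
      proof (cases "y = x")
        case True
        then show ?thesis using K by simp
      next
        case False
        have "u y *\<^sub>R G y - u x *\<^sub>R G x - u' (y - x) *\<^sub>R G x
          = (u y - u x - u' (y - x)) *\<^sub>R G y + u' (y - x) *\<^sub>R (G y - G x)"
          using u(2) by (simp add: algebra_simps)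
        then have "norm (u y *\<^sub>R G y - u x *\<^sub>R G x - u' (y - x) *\<^sub>R G x)
          \<le> norm (u y - u x - u' (y - x)) * norm (G y) + norm (u' (y - x)) * norm (G y - G x)"
          by (metis norm_scaleR norm_triangle_ineq real_norm_def)
        also have "\<dots> \<le> norm (u y - u x - u' (y - x)) * norm (G y) + (norm (y - x) * K) * norm (G y - G x)"
          by (intro add_left_mono mult_right_mono K) auto
        finally show ?thesis using False by (simp add: field_simps)
      qed
    qed
  qed (simp only: zero_le_divide_iff norm_ge_zero simp_thms eventually_True)
  then show ?thesis
    unfolding has_derivative_iff_norm
    using bounded_linear_scaleR_const[OF u'.bounded_linear_axioms] by blast
qed

text \<open>For \<open>x\<close> near \<open>a\<close> the maps \<open>B x\<close> are uniformly
  bounded below, and \<open>B x\<close> sends \<open>C x y - C a y\<close> to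
  \<open>B a (C a y) - B x (C a y)\<close>, which tends to 0.\<close>

lemma inverse_linear_family_continuous:
  fixes B :: "'a::euclidean_space \<Rightarrow> 'b::euclidean_space \<Rightarrow> 'c::euclidean_space"
    and C :: "'a \<Rightarrow> 'c \<Rightarrow> 'b"
  assumes "open S" and lin: "\<And>x. x \<in> S \<Longrightarrow> linear (B x)" "\<And>x. x \<in> S \<Longrightarrow> linear (C x)"
    and inv: "\<And>x v. x \<in> S \<Longrightarrow> C x (B x v) = v" "\<And>x y. x \<in> S \<Longrightarrow> B x (C x y) = y"
    and cont: "\<And>v. continuous_on S (\<lambda>x. B x v)"
  shows "continuous_on S (\<lambda>x. C x y)"
proof (rule continuous_at_imp_continuous_on, rule ballI)
  fix a assume a: "a \<in> S"
  have isc: "isCont (\<lambda>x. B x v) a" for v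
    using cont[of v] a \<open>open S\<close> continuous_on_eq_continuous_at by blast
  obtain K where K: "K > 0" "\<And>y. norm (C a y) \<le> K * norm y"
    using linear_bounded_pos[OF lin(2)[OF a]] by blast
  have "((\<lambda>x. \<Sum>b\<in>Basis. norm (B x b - B a b)) \<longlongrightarrow> (\<Sum>b\<in>(Basis::'b set). norm (B a b - B a b))) (at a)"
    using isc unfolding isCont_def by (intro tendsto_intros)
  then have "((\<lambda>x. \<Sum>b\<in>Basis. norm (B x b - B a b)) \<longlongrightarrow> 0) (at a)" by simp
  then have "\<forall>\<^sub>F x in at a. (\<Sum>b\<in>Basis. norm (B x b - B a b)) < 1 / (2 * K)"
    using K by (intro order_tendstoD) auto
  moreover have "\<forall>\<^sub>F x in at a. x \<in> S"
    using a \<open>open S\<close> eventually_at_in_open' by blast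
  ultimately have ev: "\<forall>\<^sub>F x in at a. norm (C x y - C a y) \<le> 2 * K * norm (B x (C a y) - B a (C a y))"
  proof eventually_elim
    case (elim x)
    \<comment> \<open>\<open>B a\<close> is bounded below by \<open>1 / K\<close>. The deviation of
      \<open>B x\<close> from \<open>B a\<close> is at most \<open>1 / (2 * K)\<close>, so half of
      that bound survives.\<close>
    have bd: "norm v \<le> 2 * K * norm (B x v)" for v
    proof -
      have l: "linear (\<lambda>v. B x v - B a v)" using lin a elim by (intro linear_compose_sub)
      have "norm (B x v - B a v) \<le> (\<Sum>b\<in>Basis. norm ((v \<bullet> b) *\<^sub>R (B x b - B a b)))"
        using linear_basis_expansion[OF l, of v] by (metis norm_sum)
      also have "\<dots> \<le> (\<Sum>b\<in>Basis. norm v * norm (B x b - B a b))"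
        by (intro sum_mono) (simp add: Basis_le_norm mult_right_mono)
      also have "\<dots> = norm v * (\<Sum>b\<in>Basis. norm (B x b - B a b))" by (simp add: sum_distrib_left)
      also have "\<dots> \<le> norm v * (1 / (2 * K))" using elim by (intro mult_left_mono) auto
      finally have 1: "norm (B x v - B a v) \<le> norm v * (1 / (2 * K))" .
      have "norm v \<le> K * norm (B a v)" using K(2)[of "B a v"] inv a by simp
      also have "\<dots> \<le> K * (norm (B x v) + norm (B x v - B a v))"
        using K norm_triangle_sub[of "B a v" "B x v"] by (intro mult_left_mono) (auto simp: norm_minus_commute)
      also have "\<dots> \<le> K * (norm (B x v) + norm v * (1 / (2 * K)))"
        using K 1 by (intro mult_left_mono add_left_mono) auto
      finally show ?thesis using K by (simp add: field_simps)
    qed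
    have "B x (C x y - C a y) = B a (C a y) - B x (C a y)"
      using elim a inv by (simp add: linear_diff[OF lin(1)])
    then show ?case using bd[of "C x y - C a y"] by (simp add: norm_minus_commute)
  qed
  have "((\<lambda>x. 2 * K * norm (B x (C a y) - B a (C a y))) \<longlongrightarrow> 2 * K * norm (B a (C a y) - B a (C a y))) (at a)"
    using isc unfolding isCont_def by (intro tendsto_intros)
  then have "((\<lambda>x. C x y - C a y) \<longlongrightarrow> 0) (at a)"
    by (intro Lim_null_comparison[OF ev]) simp
  then show "isCont (\<lambda>x. C x y) a" unfolding isCont_def using LIM_zero_iff by blast
qed

text \<open>With \<open>c = C a y\<close> one has \<open>C x y = c - C x (B x c - y)\<close> on
  \<open>S\<close>, and the residual \<open>B x c - y\<close> vanishes at \<open>a\<close>. Written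
  in components, this is a sum of vanishing differentiable factors times continuous ones, so the
  preceding product rule applies.\<close>

lemma inverse_linear_family_has_derivative:
  fixes B :: "'a::euclidean_space \<Rightarrow> 'b::euclidean_space \<Rightarrow> 'c::euclidean_space"
    and C :: "'a \<Rightarrow> 'c \<Rightarrow> 'b"
  assumes "open S" and lin: "\<And>x. x \<in> S \<Longrightarrow> linear (B x)" "\<And>x. x \<in> S \<Longrightarrow> linear (C x)"
    and inv: "\<And>x v. x \<in> S \<Longrightarrow> C x (B x v) = v" "\<And>x y. x \<in> S \<Longrightarrow> B x (C x y) = y"
    and diff: "\<And>v x. x \<in> S \<Longrightarrow> (\<lambda>x. B x v) differentiable (at x)" and a: "a \<in> S"
  shows "((\<lambda>x. C x y) has_derivative
    (\<lambda>h. - C a (frechet_derivative (\<lambda>x. B x (C a y)) (at a) h))) (at a)"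
proof -
  let ?c = "C a y" let ?r = "\<lambda>x. B x (C a y)"
  have cont: "continuous_on S (\<lambda>x. C x z)" for z
    by (rule inverse_linear_family_continuous[OF assms(1-5)])
      (auto intro!: continuous_at_imp_continuous_on differentiable_imp_continuous_within diff)
  have isc: "isCont (\<lambda>x. C x z) a" for z
    using cont[of z] a \<open>open S\<close> continuous_on_eq_continuous_at by blast
  have r: "(?r has_derivative frechet_derivative ?r (at a)) (at a)"
    using diff[OF a] by (simp add: frechet_derivative_works[symmetric])
  have "((\<lambda>x. ?c - (\<Sum>b\<in>Basis. ((?r x - y) \<bullet> b) *\<^sub>R C x b)) has_derivative
      (\<lambda>h. 0 - (\<Sum>b\<in>Basis. (frechet_derivative ?r (at a) h \<bullet> b) *\<^sub>R C a b))) (at a)"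
    by (intro has_derivative_diff has_derivative_const has_derivative_sum
        has_derivative_scaleR_vanishing isc)
      (use inv a in \<open>auto intro!: derivative_eq_intros r\<close>)
  moreover have "(\<Sum>b\<in>Basis. (frechet_derivative ?r (at a) h \<bullet> b) *\<^sub>R C a b)
      = C a (frechet_derivative ?r (at a) h)" for h
    by (rule linear_basis_expansion[OF lin(2)[OF a], symmetric])
  ultimately have "((\<lambda>x. ?c - (\<Sum>b\<in>Basis. ((?r x - y) \<bullet> b) *\<^sub>R C x b)) has_derivative
      (\<lambda>h. - C a (frechet_derivative ?r (at a) h))) (at a)"
    by simp
  then show ?thesis
  proof (rule has_derivative_transform_within_open[OF _ \<open>open S\<close> a])
    fix x assume x: "x \<in> S"
    have "(\<Sum>b\<in>Basis. ((?r x - y) \<bullet> b) *\<^sub>R C x b) = C x (?r x - y)"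
      using linear_basis_expansion[OF lin(2)[OF x]] by metis
    also have "\<dots> = ?c - C x y" using inv x by (simp add: linear_diff[OF lin(2)])
    finally show "?c - (\<Sum>b\<in>Basis. ((?r x - y) \<bullet> b) *\<^sub>R C x b) = C x y" by simp
  qed
qed

text \<open>Bootstrap: the derivative of \<open>C\<close> is a formula in \<open>C\<close> and the
  derivative of \<open>B\<close>, hence it has the class already reached by \<open>C\<close>, and
  \<open>C\<close> gains one order.\<close>

lemma Ck_on_inverse_linear_family:
  fixes B :: "'a::euclidean_space \<Rightarrow> 'b::euclidean_space \<Rightarrow> 'c::euclidean_space"
    and C :: "'a \<Rightarrow> 'c \<Rightarrow> 'b"
  assumes "open S" and lin: "\<And>x. x \<in> S \<Longrightarrow> linear (B x)" "\<And>x. x \<in> S \<Longrightarrow> linear (C x)"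
    and inv: "\<And>x v. x \<in> S \<Longrightarrow> C x (B x v) = v" "\<And>x y. x \<in> S \<Longrightarrow> B x (C x y) = y"
    and "\<And>v. Ck_on k S (\<lambda>x. B x v)"
  shows "Ck_on k S (\<lambda>x. C x y)"
  using assms(6)
proof (induction k arbitrary: y)
  case 0
  then show ?case using inverse_linear_family_continuous[OF assms(1-5)] by simp
next
  case (Suc k)
  have diff: "(\<lambda>x. B x v) differentiable (at x)" if "x \<in> S" for x v using Suc.prems[of v] that by auto
  \<comment> \<open>The derivative of \<open>B\<close> will be evaluated at the moving vector
    \<open>C x y\<close>, which calls for linearity in this slot.\<close>
  have lin_deriv: "linear (\<lambda>v. frechet_derivative (\<lambda>x. B x v) (at x) h)" if x: "x \<in> S" for x h
  proof (rule linearI)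
    have D: "((\<lambda>x. B x v) has_derivative frechet_derivative (\<lambda>x. B x v) (at x)) (at x)" for v
      using diff[OF x] by (simp add: frechet_derivative_works[symmetric])
    fix v w
    have "((\<lambda>x. B x (v + w)) has_derivative (\<lambda>h. frechet_derivative (\<lambda>x. B x v) (at x) h
        + frechet_derivative (\<lambda>x. B x w) (at x) h)) (at x)"
      by (rule has_derivative_transform_within_open[OF has_derivative_add[OF D[of v] D[of w]] \<open>open S\<close> x])
        (simp add: linear_add[OF lin(1)])
    from frechet_derivative_at[OF this]
    show "frechet_derivative (\<lambda>x. B x (v + w)) (at x) h
      = frechet_derivative (\<lambda>x. B x v) (at x) h + frechet_derivative (\<lambda>x. B x w) (at x) h"
      by metis
    fix c
    have "((\<lambda>x. B x (c *\<^sub>R v)) has_derivative (\<lambda>h. c *\<^sub>R frechet_derivative (\<lambda>x. B x v) (at x) h)) (at x)"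
      by (rule has_derivative_transform_within_open[OF has_derivative_scaleR_right[OF D[of v]] \<open>open S\<close> x])
        (simp add: linear_cmul[OF lin(1)])
    from frechet_derivative_at[OF this]
    show "frechet_derivative (\<lambda>x. B x (c *\<^sub>R v)) (at x) h = c *\<^sub>R frechet_derivative (\<lambda>x. B x v) (at x) h"
      by metis
  qed
  have C: "Ck_on k S (\<lambda>x. C x y)" for y using Suc.IH Suc.prems Ck_on_SucD by blast
  show ?case
  proof (rule Ck_on_SucI[OF \<open>open S\<close>])
    fix x assume "x \<in> S"
    then show "((\<lambda>x. C x y) has_derivative
        (\<lambda>h. - C x (frechet_derivative (\<lambda>z. B z (C x y)) (at x) h))) (at x)"
      using inverse_linear_family_has_derivative[OF assms(1-5) diff] by blast
  next
    fix h
    have "Ck_on k S (\<lambda>x. frechet_derivative (\<lambda>z. B z (C x y)) (at x) h)"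
      by (rule Ck_on_linear_family_apply[OF \<open>open S\<close> lin_deriv _ C]) (use Suc.prems in auto)
    then have "Ck_on k S (\<lambda>x. C x (frechet_derivative (\<lambda>z. B z (C x y)) (at x) h))"
      by (rule Ck_on_linear_family_apply[OF \<open>open S\<close> lin(2) C, rotated])
    then show "Ck_on k S (\<lambda>x. - C x (frechet_derivative (\<lambda>z. B z (C x y)) (at x) h))"
      using Ck_on_bounded_linear_compose[OF \<open>open S\<close> bounded_linear_minus[OF bounded_linear_ident]] by blast
  qed
qed

section \<open>Smooth maps, symmetry of second derivatives, inverse function theorem\<close>

lemma smooth_on_Ck: "smooth_on S f \<Longrightarrow> Ck_on k S f"
  by (simp add: smooth_on_def)

lemma smooth_on_cong:
  "open S \<Longrightarrow> (\<And>x. x \<in> S \<Longrightarrow> f x = g x) \<Longrightarrow> smooth_on S f \<Longrightarrow> smooth_on S g"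
  unfolding smooth_on_def by (intro allI Ck_on_cong[of S f g]) auto

lemma smooth_on_continuous: "smooth_on S f \<Longrightarrow> continuous_on S f"
  by (auto simp: smooth_on_def intro: Ck_on_continuous)

lemma smooth_on_differentiable: "smooth_on S f \<Longrightarrow> x \<in> S \<Longrightarrow> f differentiable (at x)"
  using smooth_on_Ck[of S f "Suc 0"] by auto

lemma smooth_on_has_derivative:
  "smooth_on S f \<Longrightarrow> x \<in> S \<Longrightarrow> (f has_derivative frechet_derivative f (at x)) (at x)"
  by (simp add: frechet_derivative_works[symmetric] smooth_on_differentiable)

lemma smooth_on_linear_deriv: "smooth_on S f \<Longrightarrow> x \<in> S \<Longrightarrow> linear (frechet_derivative f (at x))"
  by (simp add: linear_frechet_derivative smooth_on_differentiable)

lemma smooth_on_frechet_derivative: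
  "smooth_on S f \<Longrightarrow> smooth_on S (\<lambda>x. frechet_derivative f (at x) v)"
  unfolding smooth_on_def by (metis Ck_on.simps(2))

lemma smooth_on_subset: "smooth_on S f \<Longrightarrow> T \<subseteq> S \<Longrightarrow> smooth_on T f"
  by (auto simp: smooth_on_def intro: Ck_on_subset)

lemma smooth_on_Un: "open S \<Longrightarrow> open T \<Longrightarrow> smooth_on S f \<Longrightarrow> smooth_on T f \<Longrightarrow> smooth_on (S \<union> T) f"
  by (auto simp: smooth_on_def intro: Ck_on_Un)

lemma smooth_on_const: "open S \<Longrightarrow> smooth_on S (\<lambda>x. c)"
  by (auto simp: smooth_on_def intro: Ck_on_const)

lemma smooth_on_id: "open S \<Longrightarrow> smooth_on S (\<lambda>x. x)"
  by (auto simp: smooth_on_def intro: Ck_on_id)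

lemma smooth_on_add:
  "open S \<Longrightarrow> smooth_on S f \<Longrightarrow> smooth_on S g \<Longrightarrow> smooth_on S (\<lambda>x. f x + g x)"
  by (auto simp: smooth_on_def intro: Ck_on_add)

lemma smooth_on_bounded_linear_compose:
  "open S \<Longrightarrow> bounded_linear L \<Longrightarrow> smooth_on S f \<Longrightarrow> smooth_on S (\<lambda>x. L (f x))"
  by (auto simp: smooth_on_def intro: Ck_on_bounded_linear_compose)

lemma smooth_on_diff:
  assumes "open S" "smooth_on S f" "smooth_on S g"
  shows "smooth_on S (\<lambda>x. f x - g x)"
  using smooth_on_add[OF assms(1,2) smooth_on_bounded_linear_compose[OF assms(1)
      bounded_linear_minus[OF bounded_linear_ident] assms(3)]] by simp

lemma smooth_on_Pair:
  assumes "open S" "smooth_on S f" "smooth_on S g"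
  shows "smooth_on S (\<lambda>x. (f x, g x))"
proof -
  have "bounded_linear (\<lambda>a. (a, 0))" "bounded_linear (\<lambda>b. (0, b))"
    by (intro bounded_linear_Pair bounded_linear_ident bounded_linear_zero)+
  from smooth_on_add[OF assms(1) smooth_on_bounded_linear_compose[OF assms(1) this(1) assms(2)]
      smooth_on_bounded_linear_compose[OF assms(1) this(2) assms(3)]]
  show ?thesis by simp
qed

lemma smooth_on_compose:
  fixes f :: "'a::euclidean_space \<Rightarrow> 'b::euclidean_space" and g :: "'b \<Rightarrow> 'c::real_normed_vector"
  assumes "open S" "open T" "f ` S \<subseteq> T" "smooth_on S f" "smooth_on T g"
  shows "smooth_on S (\<lambda>x. g (f x))"
  using assms(4,5) Ck_on_compose[OF assms(1-3)] unfolding smooth_on_def by blast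

lemma smooth_on_linear_family_apply:
  fixes B :: "'a::euclidean_space \<Rightarrow> 'b::euclidean_space \<Rightarrow> 'c::real_normed_vector"
  assumes "open S" "\<And>x. x \<in> S \<Longrightarrow> linear (B x)"
    and "\<And>v. smooth_on S (\<lambda>x. B x v)" "smooth_on S w"
  shows "smooth_on S (\<lambda>x. B x (w x))"
  unfolding smooth_on_def
proof
  show "Ck_on k S (\<lambda>x. B x (w x))" for k
    by (rule Ck_on_linear_family_apply[OF assms(1,2) smooth_on_Ck[OF assms(3)] smooth_on_Ck[OF assms(4)]])
qed

lemma linear_inv:
  assumes "linear L" "bij L"
  shows "linear (inv L)"
proof -
  have "inv L (L v) = v" "L (inv L w) = w" for v w
    using assms(2) by (auto simp: bij_is_inj inv_f_f bij_is_surj surj_f_inv_f)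
  then show ?thesis by (intro linearI) (metis linear_add[OF assms(1)], metis linear_cmul[OF assms(1)])
qed

lemma smooth_on_inverse_linear_family:
  fixes B :: "'a::euclidean_space \<Rightarrow> 'b::euclidean_space \<Rightarrow> 'b"
  assumes "open S" "\<And>x. x \<in> S \<Longrightarrow> linear (B x)" "\<And>x. x \<in> S \<Longrightarrow> inj (B x)"
    and "\<And>v. smooth_on S (\<lambda>x. B x v)"
  shows "smooth_on S (\<lambda>x. inv (B x) y)"
proof -
  have "Ck_on k S (\<lambda>x. inv (B x) y)" for k
  proof (rule Ck_on_inverse_linear_family[OF assms(1,2)])
    fix x assume x: "x \<in> S"
    have s: "surj (B x)" using linear_injective_imp_surjective[OF assms(2,3)[OF x]] by simp
    then show "B x (inv (B x) y) = y" for y by (rule surj_f_inv_f)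
    show i: "inv (B x) (B x v) = v" for v using assms(3)[OF x] by (rule inv_f_f)
    show "linear (inv (B x))"
      using assms(2,3)[OF x] s by (simp add: linear_inv bij_def)
  next
    show "Ck_on k S (\<lambda>x. B x v)" for v using assms(4) by (rule smooth_on_Ck)
  qed
  then show ?thesis by (simp add: smooth_on_def)
qed

section \<open>Symmetry of second derivatives\<close>

lemma DERIV_along_line:
  fixes f :: "'a::real_normed_vector \<Rightarrow> real"
  assumes "f differentiable (at (a + t *\<^sub>R v))"
  shows "((\<lambda>t. f (a + t *\<^sub>R v)) has_real_derivative frechet_derivative f (at (a + t *\<^sub>R v)) v) (at t)"
proof -
  let ?f' = "frechet_derivative f (at (a + t *\<^sub>R v))"
  have f: "(f has_derivative ?f') (at (a + t *\<^sub>R v))"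
    using assms by (simp add: frechet_derivative_works[symmetric])
  have "((\<lambda>t. a + t *\<^sub>R v) has_derivative (\<lambda>h. h *\<^sub>R v)) (at t)"
    by (auto intro!: derivative_eq_intros)
  from diff_chain_at[OF this f]
  have "((\<lambda>t. f (a + t *\<^sub>R v)) has_derivative (\<lambda>h. ?f' (h *\<^sub>R v))) (at t)" by (simp add: o_def)
  moreover have "?f' (h *\<^sub>R v) = ?f' v * h" for h
    using linear_cmul[OF linear_frechet_derivative[OF assms]] by simp
  ultimately show ?thesis by (simp add: has_field_derivative_def)
qed

text \<open>The mean value theorem is applied twice: along \<open>v\<close> to the difference of
  \<open>f\<close> under the shift by \<open>s *\<^sub>R w\<close>, then along \<open>w\<close> to
  the directional derivative \<open>?F\<close>.\<close>

lemma second_difference_mean_value: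
  fixes f :: "'a::euclidean_space \<Rightarrow> real"
  assumes C2: "Ck_on (Suc (Suc 0)) (ball p r) f" and s: "s > 0" "s * (norm v + norm w) < r"
  shows "\<exists>q\<in>ball p r. f (p + s *\<^sub>R v + s *\<^sub>R w) - f (p + s *\<^sub>R v) - f (p + s *\<^sub>R w) + f p
     = s * s * frechet_derivative (\<lambda>x. frechet_derivative f (at x) v) (at q) w"
proof -
  let ?F = "\<lambda>x. frechet_derivative f (at x) v"
  have mem: "p + a *\<^sub>R v + b *\<^sub>R w \<in> ball p r" if "0 \<le> a" "a \<le> s" "0 \<le> b" "b \<le> s" for a b
  proof -
    have "norm (a *\<^sub>R v + b *\<^sub>R w) \<le> a * norm v + b * norm w"
      using that norm_triangle_ineq[of "a *\<^sub>R v" "b *\<^sub>R w"] by simp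
    also have "\<dots> \<le> s * norm v + s * norm w"
      using that by (intro add_mono mult_right_mono) auto
    finally have "norm (a *\<^sub>R v + b *\<^sub>R w) < r" using s by (simp add: algebra_simps)
    then show ?thesis by (simp add: dist_norm algebra_simps norm_minus_commute)
  qed
  have df: "f differentiable (at x)" "?F differentiable (at x)" if "x \<in> ball p r" for x
    using C2 that by auto
  have "\<exists>\<xi>>0. \<xi> < s \<and> (f ((p + s *\<^sub>R w) + s *\<^sub>R v) - f (p + s *\<^sub>R v))
      - (f ((p + s *\<^sub>R w) + 0 *\<^sub>R v) - f (p + 0 *\<^sub>R v))
      = (s - 0) * (?F ((p + s *\<^sub>R w) + \<xi> *\<^sub>R v) - ?F (p + \<xi> *\<^sub>R v))"
  proof (rule MVT2[OF s(1)])
    fix t assume "0 \<le> t" "t \<le> s"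
    then have "(p + s *\<^sub>R w) + t *\<^sub>R v \<in> ball p r" "p + t *\<^sub>R v \<in> ball p r"
      using mem[of t s] mem[of t 0] s by (auto simp: algebra_simps)
    then show "((\<lambda>t. f ((p + s *\<^sub>R w) + t *\<^sub>R v) - f (p + t *\<^sub>R v)) has_real_derivative
        (?F ((p + s *\<^sub>R w) + t *\<^sub>R v) - ?F (p + t *\<^sub>R v))) (at t)"
      by (intro DERIV_diff DERIV_along_line df)
  qed
  then obtain \<xi> where \<xi>: "0 < \<xi>" "\<xi> < s" "f (p + s *\<^sub>R v + s *\<^sub>R w) - f (p + s *\<^sub>R v) - f (p + s *\<^sub>R w) + f p
      = s * (?F (p + \<xi> *\<^sub>R v + s *\<^sub>R w) - ?F (p + \<xi> *\<^sub>R v))"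
    by (auto simp: algebra_simps)
  have "\<exists>\<eta>>0. \<eta> < s \<and> ?F ((p + \<xi> *\<^sub>R v) + s *\<^sub>R w) - ?F ((p + \<xi> *\<^sub>R v) + 0 *\<^sub>R w)
      = (s - 0) * frechet_derivative ?F (at ((p + \<xi> *\<^sub>R v) + \<eta> *\<^sub>R w)) w"
  proof (rule MVT2[OF s(1)])
    fix t assume "0 \<le> t" "t \<le> s"
    then have "(p + \<xi> *\<^sub>R v) + t *\<^sub>R w \<in> ball p r" using mem[of \<xi> t] \<xi> by auto
    then show "((\<lambda>t. ?F ((p + \<xi> *\<^sub>R v) + t *\<^sub>R w)) has_real_derivative
        frechet_derivative ?F (at ((p + \<xi> *\<^sub>R v) + t *\<^sub>R w)) w) (at t)"
      by (intro DERIV_along_line df)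
  qed
  then obtain \<eta> where \<eta>: "0 < \<eta>" "\<eta> < s" "?F (p + \<xi> *\<^sub>R v + s *\<^sub>R w) - ?F (p + \<xi> *\<^sub>R v)
      = s * frechet_derivative ?F (at (p + \<xi> *\<^sub>R v + \<eta> *\<^sub>R w)) w"
    by auto
  have "p + \<xi> *\<^sub>R v + \<eta> *\<^sub>R w \<in> ball p r" using mem[of \<xi> \<eta>] \<xi>(1,2) \<eta>(1,2) by linarith
  then show ?thesis unfolding \<xi>(3) \<eta>(3) by (rule bexI[rotated]) (rule mult.assoc[symmetric])
qed

text \<open>Exchanging \<open>v\<close> and \<open>w\<close> leaves the second difference unchanged,
  so the two mixed derivatives agree at some points \<open>q\<close> and \<open>q'\<close> near
  \<open>p\<close>. By continuity a gap at \<open>p\<close> would persist there.\<close>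

lemma second_derivative_symmetric_real:
  fixes f :: "'a::euclidean_space \<Rightarrow> real"
  assumes "open S" "p \<in> S" and C2: "Ck_on (Suc (Suc 0)) S f"
  shows "frechet_derivative (\<lambda>x. frechet_derivative f (at x) v) (at p) w
       = frechet_derivative (\<lambda>x. frechet_derivative f (at x) w) (at p) v"
proof (rule ccontr)
  let ?A = "\<lambda>q. frechet_derivative (\<lambda>x. frechet_derivative f (at x) v) (at q) w"
  let ?B = "\<lambda>q. frechet_derivative (\<lambda>x. frechet_derivative f (at x) w) (at q) v"
  assume ne: "?A p \<noteq> ?B p"
  define e where "e = \<bar>?A p - ?B p\<bar> / 2"
  have "e > 0" using ne by (simp add: e_def)
  have "continuous_on S ?A" "continuous_on S ?B" using C2 by auto
  then have "isCont ?A p" "isCont ?B p"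
    using assms continuous_on_eq_continuous_at by blast+
  then obtain d1 d2 where d: "d1 > 0" "d2 > 0" "\<And>q. dist q p < d1 \<Longrightarrow> dist (?A q) (?A p) < e"
      "\<And>q. dist q p < d2 \<Longrightarrow> dist (?B q) (?B p) < e"
    using \<open>e > 0\<close> unfolding continuous_at_eps_delta by metis
  obtain d3 where d3: "d3 > 0" "ball p d3 \<subseteq> S" using assms openE by blast
  define r where "r = min d1 (min d2 d3)"
  have r: "r > 0" "ball p r \<subseteq> S" using d d3 by (auto simp: r_def)
  have C2': "Ck_on (Suc (Suc 0)) (ball p r) f" using C2 r(2) by (rule Ck_on_subset)
  \<comment> \<open>The summand 1 keeps the denominator positive for zero directions and makes the
    required inequality strict.\<close>
  define s where "s = r / (norm v + norm w + 1)"
  have pos: "norm v + norm w + 1 > 0" by (smt (verit) norm_ge_zero)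
  then have s: "s > 0" using r by (simp add: s_def)
  have "s * (norm v + norm w) < r" using r pos by (simp add: s_def field_simps)
  then have s': "s * (norm v + norm w) < r" "s * (norm w + norm v) < r" by (simp_all add: add.commute)
  obtain q where q: "q \<in> ball p r"
    "f (p + s *\<^sub>R v + s *\<^sub>R w) - f (p + s *\<^sub>R v) - f (p + s *\<^sub>R w) + f p = s * s * ?A q"
    using second_difference_mean_value[OF C2' s s'(1)] by blast
  obtain q' where q': "q' \<in> ball p r"
    "f (p + s *\<^sub>R w + s *\<^sub>R v) - f (p + s *\<^sub>R w) - f (p + s *\<^sub>R v) + f p = s * s * ?B q'"
    using second_difference_mean_value[OF C2' s s'(2)] by blast
  have swap: "p + s *\<^sub>R w + s *\<^sub>R v = p + s *\<^sub>R v + s *\<^sub>R w" by (simp add: algebra_simps)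
  have "s * s * ?A q = s * s * ?B q'" unfolding q(2)[symmetric] q'(2)[symmetric] swap by simp
  then have "?A q = ?B q'" using s by simp
  moreover have "dist (?A q) (?A p) < e" "dist (?B q') (?B p) < e"
    using q(1) q'(1) d(3)[of q] d(4)[of q'] by (auto simp: r_def dist_commute)
  moreover have "a = d \<Longrightarrow> \<bar>a - b\<bar> < \<bar>b - c\<bar> / 2 \<Longrightarrow> \<bar>d - c\<bar> < \<bar>b - c\<bar> / 2 \<Longrightarrow> False"
    for a b c d :: real by (auto simp: abs_if split: if_splits)
  ultimately show False unfolding e_def dist_real_def by blast
qed

lemma second_derivative_symmetric:
  fixes f :: "'a::euclidean_space \<Rightarrow> 'b::euclidean_space"
  assumes S: "open S" "p \<in> S" and f: "smooth_on S f"
  shows "frechet_derivative (\<lambda>x. frechet_derivative f (at x) v) (at p) w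
       = frechet_derivative (\<lambda>x. frechet_derivative f (at x) w) (at p) v"
proof (rule euclidean_eqI)
  fix b :: 'b assume "b \<in> Basis"
  have inner: "frechet_derivative (\<lambda>x. g x \<bullet> b) (at x) h = frechet_derivative g (at x) h \<bullet> b"
    if "smooth_on S g" "x \<in> S" for g :: "'a \<Rightarrow> 'b" and x h
    using frechet_derivative_at[OF bounded_linear.has_derivative[OF bounded_linear_inner_left
          smooth_on_has_derivative[OF that]], of b] by metis
  have second: "frechet_derivative (\<lambda>x. frechet_derivative (\<lambda>x. f x \<bullet> b) (at x) v) (at p) w
      = frechet_derivative (\<lambda>x. frechet_derivative f (at x) v) (at p) w \<bullet> b" for v w
  proof -
    let ?D = "frechet_derivative (\<lambda>x. frechet_derivative f (at x) v) (at p)"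
    have "((\<lambda>x. frechet_derivative f (at x) v \<bullet> b) has_derivative (\<lambda>h. ?D h \<bullet> b)) (at p)"
      by (rule bounded_linear.has_derivative[OF bounded_linear_inner_left
          smooth_on_has_derivative[OF smooth_on_frechet_derivative[OF f] S(2)]])
    then have "((\<lambda>x. frechet_derivative (\<lambda>x. f x \<bullet> b) (at x) v) has_derivative (\<lambda>h. ?D h \<bullet> b)) (at p)"
      by (rule has_derivative_transform_within_open[OF _ S]) (simp add: inner[OF f])
    from frechet_derivative_at[OF this] show ?thesis by metis
  qed
  have "smooth_on S (\<lambda>x. f x \<bullet> b)"
    by (rule smooth_on_bounded_linear_compose[OF S(1) bounded_linear_inner_left f])
  from second_derivative_symmetric_real[OF S smooth_on_Ck[OF this], of v w]
  show "frechet_derivative (\<lambda>x. frechet_derivative f (at x) v) (at p) w \<bullet> b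
       = frechet_derivative (\<lambda>x. frechet_derivative f (at x) w) (at p) v \<bullet> b"
    by (simp only: second)
qed

section \<open>Restriction of diffeomorphisms and local invertibility\<close>

lemma diffeo_on_subset:
  assumes "diffeo_on S \<phi>" "open T" "T \<subseteq> S"
  shows "diffeo_on T \<phi>"
proof -
  obtain \<psi> where \<psi>: "smooth_on (\<phi> ` S) \<psi>" "\<And>x. x \<in> S \<Longrightarrow> \<psi> (\<phi> x) = x" "open (\<phi> ` S)" "smooth_on S \<phi>"
    using assms(1) unfolding diffeo_on_def by blast
  have "\<phi> ` T = \<phi> ` S \<inter> \<psi> -` T" using \<psi>(2) assms(3) by force
  then have "open (\<phi> ` T)"
    using continuous_open_preimage[OF smooth_on_continuous[OF \<psi>(1)] \<psi>(3) assms(2)] by simp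
  moreover have "smooth_on (\<phi> ` T) \<psi>"
    by (rule smooth_on_subset[OF \<psi>(1)]) (use assms(3) in auto)
  moreover have "smooth_on T \<phi>" using \<psi>(4) assms(3) by (rule smooth_on_subset)
  ultimately show ?thesis
    unfolding diffeo_on_def using \<psi>(2) assms(2,3) by blast
qed

lemma diffeo_on_inj_deriv:
  assumes "diffeo_on S \<phi>" "x \<in> S"
  shows "inj (frechet_derivative \<phi> (at x))"
proof -
  obtain \<psi> where \<psi>: "smooth_on (\<phi> ` S) \<psi>" "\<And>x. x \<in> S \<Longrightarrow> \<psi> (\<phi> x) = x" "smooth_on S \<phi>" "open S"
    using assms(1) unfolding diffeo_on_def by blast
  have "(\<psi> has_derivative frechet_derivative \<psi> (at (\<phi> x))) (at (\<phi> x))"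
    using \<psi>(1) assms(2) by (intro smooth_on_has_derivative) auto
  from diff_chain_at[OF smooth_on_has_derivative[OF \<psi>(3) assms(2)] this]
  have "((\<lambda>x. x) has_derivative frechet_derivative \<psi> (at (\<phi> x)) \<circ> frechet_derivative \<phi> (at x)) (at x)"
    by (rule has_derivative_transform_within_open[OF _ \<psi>(4) assms(2)]) (simp add: \<psi>(2))
  then have "frechet_derivative \<psi> (at (\<phi> x)) \<circ> frechet_derivative \<phi> (at x) = (\<lambda>x. x)"
    using has_derivative_unique has_derivative_ident by blast
  then show ?thesis by (metis inj_on_id2 inj_on_imageI2)
qed

text \<open>The classical theorem supplies a homeomorphic inverse \<open>g\<close> whose derivative
  at \<open>y\<close> is the inverse of the derivative of \<open>f\<close> at \<open>g y\<close>. If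
  \<open>g\<close> is of class \<open>k\<close>, this family of inverses is too, which raises
  \<open>g\<close> to class \<open>Suc k\<close>.\<close>

theorem smooth_inverse_function_theorem:
  fixes f :: "'a::euclidean_space \<Rightarrow> 'a"
  assumes S: "open S" "p \<in> S" and f: "smooth_on S f" and inj: "inj (frechet_derivative f (at p))"
  obtains U where "p \<in> U" "U \<subseteq> S" "diffeo_on U f"
proof -
  define f' where "f' x = Blinfun (frechet_derivative f (at x))" for x
  have bl: "bounded_linear (frechet_derivative f (at x))" if "x \<in> S" for x
    using smooth_on_has_derivative[OF f that] by (rule has_derivative_bounded_linear)
  have f': "blinfun_apply (f' x) = frechet_derivative f (at x)" if "x \<in> S" for x
    unfolding f'_def using bl[OF that] by (rule bounded_linear_Blinfun_apply)
  have der: "(f has_derivative blinfun_apply (f' x)) (at x)" if "x \<in> S" for x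
    using f'[OF that] smooth_on_has_derivative[OF f that] by simp
  have cont: "continuous_on S f'"
  proof (rule continuous_on_blinfun_componentwise)
    fix i :: 'a
    show "continuous_on S (\<lambda>x. f' x i)"
      using smooth_on_continuous[OF smooth_on_frechet_derivative[OF f, of i]] f'
      by (simp cong: continuous_on_cong)
  qed
  have lin: "linear (frechet_derivative f (at p))" using f S(2) by (rule smooth_on_linear_deriv)
  obtain L where L: "linear L" "L \<circ> frechet_derivative f (at p) = id"
    using linear_injective_left_inverse[OF lin inj] by blast
  have left_inv: "Blinfun L o\<^sub>L f' p = id_blinfun"
  proof (rule blinfun_eqI)
    fix x
    have "blinfun_apply (Blinfun L) = L"
      using L(1) by (simp add: bounded_linear_Blinfun_apply linear_conv_bounded_linear)
    then show "(Blinfun L o\<^sub>L f' p) x = id_blinfun x"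
      using f'[OF S(2)] L(2) by (simp add: fun_eq_iff)
  qed
  show thesis
  proof (rule inverse_function_theorem[OF S(1) der cont S(2) left_inv])
    fix U V g g'
    assume U: "open U" "U \<subseteq> S" "p \<in> U" and V: "open V" "f p \<in> V" "homeomorphism U V f g"
      and g: "\<And>y. y \<in> V \<Longrightarrow> (g has_derivative g' y) (at y)"
        "\<And>y. y \<in> V \<Longrightarrow> g' y = inv (blinfun_apply (f' (g y)))"
        "\<And>y. y \<in> V \<Longrightarrow> bij (blinfun_apply (f' (g y)))"
    have gU: "g y \<in> U" if "y \<in> V" for y using V(3) that by (auto simp: homeomorphism_def)
    have gS: "g y \<in> S" if "y \<in> V" for y using gU[OF that] U by auto
    have fU: "f ` U = V" using V(3) by (simp add: homeomorphism_def)
    let ?B = "\<lambda>y. frechet_derivative f (at (g y))"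
    have Ck: "Ck_on k V g" for k
    proof (induction k)
      case 0
      then show ?case using V(3) by (simp add: homeomorphism_def)
    next
      case (Suc k)
      have B: "Ck_on k V (\<lambda>y. ?B y v)" for v
        by (rule Ck_on_compose[OF V(1) S(1) _ Suc smooth_on_Ck[OF smooth_on_frechet_derivative[OF f]]])
          (use gS in auto)
      have inv: "Ck_on k V (\<lambda>y. inv (?B y) v)" for v
      proof (rule Ck_on_inverse_linear_family[OF V(1) _ _ _ _ B])
        fix y assume y: "y \<in> V"
        have bij: "bij (?B y)" using g(3)[OF y] f' gS[OF y] by simp
        show l: "linear (?B y)" using f gS[OF y] by (rule smooth_on_linear_deriv)
        show "?B y (inv (?B y) z) = z" for z using bij by (simp add: bij_is_surj surj_f_inv_f)
        show "inv (?B y) (?B y z) = z" for z using bij by (simp add: bij_is_inj inv_f_f)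
        show "linear (inv (?B y))"
          using l bij by (rule linear_inv)
      qed
      show ?case
        by (rule Ck_on_SucI[OF V(1) g(1)]) (use inv g(2) f' gS in \<open>auto intro: Ck_on_cong[OF V(1) _ inv]\<close>)
    qed
    then have "smooth_on V g" by (simp add: smooth_on_def)
    then have "diffeo_on U f"
      unfolding diffeo_on_def using U V(1) smooth_on_subset[OF f U(2)] fU V(3)
      by (auto simp: homeomorphism_def)
    with U that show thesis by blast
  qed
qed

section \<open>Necessity\<close>

lemma input_dist_eq: "input_dist p = {q :: (real^'n) \<times> (real^'m). fst q = 0}"
proof
  have "subspace {q :: (real^'n) \<times> (real^'m). fst q = 0}"
    by (auto simp: subspace_def)
  then show "input_dist p \<subseteq> {q. fst q = 0}"
    unfolding input_dist_def by (intro span_minimal) auto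
next
  show "{q. fst q = 0} \<subseteq> (input_dist p :: ((real^'n) \<times> (real^'m)) set)"
  proof clarify
    fix a :: "real^'n" and u :: "real^'m"
    assume "fst (a, u) = 0"
    then have "(a, u) = (\<Sum>j\<in>UNIV. (u $ j) *\<^sub>R ((0 :: real^'n), axis j (1::real)))"
      using basis_expansion[of u]
      by (simp add: prod_eq_iff fst_sum snd_sum scalar_mult_eq_scaleR)
    also have "\<dots> \<in> input_dist p"
      unfolding input_dist_def by (intro span_sum span_scale span_base) auto
    finally show "(a, u) \<in> input_dist p" .
  qed
qed

lemma frechet_derivative_vec_nth:
  assumes "f differentiable (at p)"
  shows "frechet_derivative (\<lambda>q. f q $ i) (at p) v = frechet_derivative f (at p) v $ i"
proof -
  have "(f has_derivative frechet_derivative f (at p)) (at p)"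
    using assms by (simp add: frechet_derivative_works[symmetric])
  from frechet_derivative_at[OF bounded_linear.has_derivative[OF bounded_linear_vec_nth this, of i]]
  show ?thesis by metis
qed

lemma kernel_dist_eq:
  "f differentiable (at p) \<Longrightarrow> kernel_dist f p = {v. frechet_derivative f (at p) v = 0}"
  by (simp add: kernel_dist_def frechet_derivative_vec_nth vec_eq_iff)

text \<open>K is the kernel of the differential of \<open>f\<close>, so membership in U + K is
  decided by the image under that differential. This turns the bracket condition into a statement
  about the image of the input directions.\<close>

lemma sum_dist_input_kernel_iff:
  assumes "f differentiable (at p)"
  shows "\<xi> \<in> sum_dist input_dist (kernel_dist f) p \<longleftrightarrow>
    (\<exists>\<eta>. frechet_derivative f (at p) \<xi> = frechet_derivative f (at p) (0, \<eta>))"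
proof
  note lin = linear_frechet_derivative[OF assms]
  assume "\<xi> \<in> sum_dist input_dist (kernel_dist f) p"
  then obtain a b where ab: "\<xi> = a + b" "fst a = 0" "frechet_derivative f (at p) b = 0"
    by (auto simp: sum_dist_def input_dist_eq kernel_dist_eq[OF assms])
  have "a = (0, snd a)" using ab(2) by (simp add: prod_eq_iff)
  then have "frechet_derivative f (at p) \<xi> = frechet_derivative f (at p) (0, snd a)"
    using ab(1,3) linear_add[OF lin, of a b] by simp
  then show "\<exists>\<eta>. frechet_derivative f (at p) \<xi> = frechet_derivative f (at p) (0, \<eta>)" by blast
next
  note lin = linear_frechet_derivative[OF assms]
  assume "\<exists>\<eta>. frechet_derivative f (at p) \<xi> = frechet_derivative f (at p) (0, \<eta>)"
  then obtain \<eta> where \<eta>: "frechet_derivative f (at p) \<xi> = frechet_derivative f (at p) (0, \<eta>)" by blast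
  have "\<xi> = (0, \<eta>) + (\<xi> - (0, \<eta>))" by simp
  moreover have "frechet_derivative f (at p) (\<xi> - (0, \<eta>)) = 0"
    using \<eta> linear_diff[OF lin] by simp
  ultimately show "\<xi> \<in> sum_dist input_dist (kernel_dist f) p"
    unfolding sum_dist_def input_dist_eq kernel_dist_eq[OF assms]
    by (metis (mono_tags, lifting) fst_conv mem_Collect_eq)
qed

text \<open>\<open>bracket_dist\<close> is a span; once the target is a subspace, containment can be
  tested on single brackets.\<close>

lemma subspace_sum_dist_input_kernel:
  assumes "f differentiable (at p)"
  shows "subspace (sum_dist input_dist (kernel_dist f) p)"
proof -
  note lin = linear_frechet_derivative[OF assms]
  show ?thesis
  proof (rule subspaceI)
    show "0 \<in> sum_dist input_dist (kernel_dist f) p"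
      unfolding sum_dist_input_kernel_iff[OF assms] by (intro exI[of _ 0]) (simp add: zero_prod_def)
  next
    fix x y
    assume "x \<in> sum_dist input_dist (kernel_dist f) p" "y \<in> sum_dist input_dist (kernel_dist f) p"
    then obtain a b where "frechet_derivative f (at p) x = frechet_derivative f (at p) (0, a)"
      "frechet_derivative f (at p) y = frechet_derivative f (at p) (0, b)"
      unfolding sum_dist_input_kernel_iff[OF assms] by blast
    then have "frechet_derivative f (at p) (x + y) = frechet_derivative f (at p) (0, a + b)"
      using linear_add[OF lin, of "(0, a)" "(0, b)"] linear_add[OF lin, of x y] by simp
    then show "x + y \<in> sum_dist input_dist (kernel_dist f) p"
      unfolding sum_dist_input_kernel_iff[OF assms] by blast
  next
    fix c x
    assume "x \<in> sum_dist input_dist (kernel_dist f) p"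
    then obtain a where "frechet_derivative f (at p) x = frechet_derivative f (at p) (0, a)"
      unfolding sum_dist_input_kernel_iff[OF assms] by blast
    then have "frechet_derivative f (at p) (c *\<^sub>R x) = frechet_derivative f (at p) (0, c *\<^sub>R a)"
      using linear_cmul[OF lin, of c "(0, a)"] linear_cmul[OF lin, of c x] by simp
    then show "c *\<^sub>R x \<in> sum_dist input_dist (kernel_dist f) p"
      unfolding sum_dist_input_kernel_iff[OF assms] by blast
  qed
qed

section \<open>Derivatives along vector fields and Lie brackets\<close>

lemma derivative_along_field_has_derivative:
  fixes y :: "'a::euclidean_space \<Rightarrow> 'b::real_normed_vector"
  assumes D: "open D" "p \<in> D" and y: "smooth_on D y" and w: "smooth_on D w"
  shows "((\<lambda>q. frechet_derivative y (at q) (w q)) has_derivative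
    (\<lambda>h. frechet_derivative (\<lambda>q. frechet_derivative y (at q) (w p)) (at p) h
       + frechet_derivative y (at p) (frechet_derivative w (at p) h))) (at p)"
proof -
  let ?y' = "\<lambda>q. frechet_derivative y (at q)"
  let ?Y = "\<lambda>b. frechet_derivative (\<lambda>q. ?y' q b) (at p)"
  have lin: "linear (?y' q)" if "q \<in> D" for q using y that by (rule smooth_on_linear_deriv)
  have Y: "((\<lambda>q. ?y' q b) has_derivative ?Y b) (at p)" for b
    by (rule smooth_on_has_derivative[OF smooth_on_frechet_derivative[OF y] D(2)])
  have w': "((\<lambda>q. w q \<bullet> b) has_derivative (\<lambda>h. frechet_derivative w (at p) h \<bullet> b)) (at p)" for b
    by (rule bounded_linear.has_derivative[OF bounded_linear_inner_left smooth_on_has_derivative[OF w D(2)]])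
  have "((\<lambda>q. \<Sum>b\<in>Basis. (w p \<bullet> b) *\<^sub>R ?y' q b) has_derivative (\<lambda>h. \<Sum>b\<in>Basis. (w p \<bullet> b) *\<^sub>R ?Y b h)) (at p)"
    by (intro has_derivative_sum has_derivative_scaleR_right Y)
  \<comment> \<open>Differentiability of \<open>?y'\<close> is known for fixed arguments. With
    coefficients frozen at \<open>w p\<close> the sum gives the second derivative in that direction;
    varying coefficients add the term with the derivative of \<open>w\<close>.\<close>
  then have "((\<lambda>q. ?y' q (w p)) has_derivative (\<lambda>h. \<Sum>b\<in>Basis. (w p \<bullet> b) *\<^sub>R ?Y b h)) (at p)"
    by (rule has_derivative_transform_within_open[OF _ D]) (rule linear_basis_expansion[OF lin, symmetric])
  from frechet_derivative_at[OF this, symmetric]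
  have Yw: "?Y (w p) h = (\<Sum>b\<in>Basis. (w p \<bullet> b) *\<^sub>R ?Y b h)" for h
    by (rule fun_cong)
  have "((\<lambda>q. \<Sum>b\<in>Basis. (w q \<bullet> b) *\<^sub>R ?y' q b) has_derivative
      (\<lambda>h. \<Sum>b\<in>Basis. (w p \<bullet> b) *\<^sub>R ?Y b h + (frechet_derivative w (at p) h \<bullet> b) *\<^sub>R ?y' p b)) (at p)"
    by (intro has_derivative_sum has_derivative_scaleR w' Y)
  then have "((\<lambda>q. ?y' q (w q)) has_derivative
      (\<lambda>h. \<Sum>b\<in>Basis. (w p \<bullet> b) *\<^sub>R ?Y b h + (frechet_derivative w (at p) h \<bullet> b) *\<^sub>R ?y' p b)) (at p)"
    by (rule has_derivative_transform_within_open[OF _ D]) (rule linear_basis_expansion[OF lin, symmetric])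
  moreover have "(\<Sum>b\<in>Basis. (w p \<bullet> b) *\<^sub>R ?Y b h + (frechet_derivative w (at p) h \<bullet> b) *\<^sub>R ?y' p b)
      = ?Y (w p) h + ?y' p (frechet_derivative w (at p) h)" for h
    unfolding Yw linear_basis_expansion[OF lin[OF D(2)], of "frechet_derivative w (at p) h"]
    by (rule sum.distrib)
  ultimately show ?thesis by simp
qed

text \<open>Differentiating the identity that \<open>w\<close> annihilates \<open>y\<close> trades
  the derivative of \<open>w\<close> for a second derivative of \<open>y\<close>.\<close>

lemma derivative_along_annihilating_field:
  fixes y :: "'a::euclidean_space \<Rightarrow> 'b::real_normed_vector"
  assumes D: "open D" "p \<in> D" and y: "smooth_on D y" and w: "smooth_on D w"
    and zero: "\<And>q. q \<in> D \<Longrightarrow> frechet_derivative y (at q) (w q) = 0"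
  shows "frechet_derivative (\<lambda>q. frechet_derivative y (at q) (w p)) (at p) h
       = - frechet_derivative y (at p) (frechet_derivative w (at p) h)"
proof -
  have "((\<lambda>q. 0) has_derivative
      (\<lambda>h. frechet_derivative (\<lambda>q. frechet_derivative y (at q) (w p)) (at p) h
         + frechet_derivative y (at p) (frechet_derivative w (at p) h))) (at p)"
    by (rule has_derivative_transform_within_open[OF derivative_along_field_has_derivative[OF D y w] D])
      (rule zero)
  from has_derivative_unique[OF this has_derivative_const]
  show ?thesis by (metis eq_neg_iff_add_eq_0)
qed

text \<open>Both halves of the bracket turn into second derivatives of \<open>y\<close> in the
  directions \<open>v p\<close> and \<open>w p\<close>, and these cancel by symmetry.\<close>

lemma lie_bracket_annihilates:
  fixes y :: "'a::euclidean_space \<Rightarrow> 'b::euclidean_space"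
  assumes D: "open D" "p \<in> D" and y: "smooth_on D y" and v: "smooth_on D v" and w: "smooth_on D w"
    and zero: "\<And>q. q \<in> D \<Longrightarrow> frechet_derivative y (at q) (v q) = 0"
      "\<And>q. q \<in> D \<Longrightarrow> frechet_derivative y (at q) (w q) = 0"
  shows "frechet_derivative y (at p) (lie_bracket v w p) = 0"
  unfolding lie_bracket_def linear_diff[OF smooth_on_linear_deriv[OF y D(2)]]
  using derivative_along_annihilating_field[OF D y w zero(2), of "v p"]
    derivative_along_annihilating_field[OF D y v zero(1), of "w p"]
    second_derivative_symmetric[OF D y, of "v p" "w p"]
  by (metis cancel_comm_monoid_add_class.diff_cancel minus_equation_iff)

section \<open>Necessity, read off in the transformed coordinates\<close>

lemma bracket_condition_if_transformable:
  fixes f :: "(real^'n) \<times> (real^'m) \<Rightarrow> real^'n"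
  assumes D: "open D" and f: "smooth_on D f"
    and inj: "\<And>p \<eta>. p \<in> D \<Longrightarrow> frechet_derivative f (at p) (0, \<eta>) = 0 \<Longrightarrow> \<eta> = 0"
    and "transformable_on X D f decomposed_form"
  shows "bracket_condition D f"
proof -
  obtain W and \<phi> :: "real^'n \<Rightarrow> real^'n" and \<phi>u :: "(real^'n) \<times> (real^'m) \<Rightarrow> real^'m" and g
    where tr: "W \<subseteq> X \<and> fst ` D \<subseteq> W \<and> f ` D \<subseteq> W \<and> diffeo_on W \<phi> \<and>
      diffeo_on D (\<lambda>(x, u). (\<phi> x, \<phi>u (x, u))) \<and>
      (\<forall>(x, u)\<in>D. \<phi> (f (x, u)) = g (\<phi> x, \<phi>u (x, u))) \<and>
      decomposed_form ((\<lambda>(x, u). (\<phi> x, \<phi>u (x, u))) ` D) g"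
    using assms(4) unfolding transformable_on_def by (elim exE) (rule that)
  then have W: "fst ` D \<subseteq> W" "f ` D \<subseteq> W" and \<phi>: "diffeo_on W \<phi>"
    and \<Phi>: "diffeo_on D (\<lambda>(x, u). (\<phi> x, \<phi>u (x, u)))"
    and g: "\<And>x u. (x, u) \<in> D \<Longrightarrow> \<phi> (f (x, u)) = g (\<phi> x, \<phi>u (x, u))"
    by auto
  obtain \<beta> :: "'m \<Rightarrow> 'n" and fa where dec: "inj \<beta> \<and>
      (\<forall>i. i \<notin> range \<beta> \<longrightarrow> smooth_on (fst ` (\<lambda>(x, u). (\<phi> x, \<phi>u (x, u))) ` D) (fa i)) \<and>
      (\<forall>(x, u)\<in>(\<lambda>(x, u). (\<phi> x, \<phi>u (x, u))) ` D. (\<forall>i. i \<notin> range \<beta> \<longrightarrow> g (x, u) $ i = fa i x) \<and>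
         (\<forall>j. g (x, u) $ \<beta> j = u $ j))"
    using tr[THEN conjunct2, THEN conjunct2, THEN conjunct2, THEN conjunct2, THEN conjunct2, THEN conjunct2]
    unfolding decomposed_form_def by (elim exE) (rule that)
  then have fa: "\<And>i. i \<notin> range \<beta> \<Longrightarrow> smooth_on (fst ` (\<lambda>(x, u). (\<phi> x, \<phi>u (x, u))) ` D) (fa i)"
    and gfa: "\<And>x u i. (x, u) \<in> D \<Longrightarrow> i \<notin> range \<beta> \<Longrightarrow> g (\<phi> x, \<phi>u (x, u)) $ i = fa i (\<phi> x)"
    by auto
  have img: "fst ` (\<lambda>(x, u). (\<phi> x, \<phi>u (x, u))) ` D = \<phi> ` fst ` D" by force
  have "open ((\<lambda>(x, u). (\<phi> x, \<phi>u (x, u))) ` D)" using \<Phi> by (simp add: diffeo_on_def)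
  then have open_img: "open (\<phi> ` fst ` D)" unfolding img[symmetric] by (rule open_image_fst)
  have open_fst: "open (fst ` D)" using D by (rule open_image_fst)
  have W': "open W" "smooth_on W \<phi>" using \<phi> by (auto simp: diffeo_on_def)
  \<comment> \<open>The new successor state as a function of the original coordinates. Its
    components outside \<open>range \<beta>\<close> depend on the state alone.\<close>
  define Y where "Y q = \<phi> (f q)" for q
  have Y: "smooth_on D Y"
    unfolding Y_def by (rule smooth_on_compose[OF D W'(1) W(2) f W'(2)])
  have dY: "frechet_derivative Y (at q) h = frechet_derivative \<phi> (at (f q)) (frechet_derivative f (at q) h)"
    if "q \<in> D" for q h
  proof -
    have "f q \<in> W" using W(2) that by auto
    from diff_chain_at[OF smooth_on_has_derivative[OF f that] smooth_on_has_derivative[OF W'(2) this]]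
    have "(Y has_derivative frechet_derivative \<phi> (at (f q)) \<circ> frechet_derivative f (at q)) (at q)"
      by (simp add: Y_def[abs_def] o_def)
    then show ?thesis using frechet_derivative_at comp_apply by metis
  qed
  have dY_input: "frechet_derivative Y (at q) h $ i = 0"
    if q: "q \<in> D" and h: "fst h = 0" and i: "i \<notin> range \<beta>" for q h i
  proof -
    let ?H = "\<lambda>x. fa i (\<phi> x)"
    have "smooth_on (fst ` D) ?H"
      by (rule smooth_on_compose[OF open_fst open_img order.refl smooth_on_subset[OF W'(2) W(1)]
            fa[OF i, unfolded img]])
    then have H: "(?H has_derivative frechet_derivative ?H (at (fst q))) (at (fst q))"
      using q by (intro smooth_on_has_derivative) auto
    have "(fst has_derivative fst) (at q)"
      by (rule bounded_linear.has_derivative[OF bounded_linear_fst has_derivative_ident])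
    from diff_chain_at[OF this H]
    have "((\<lambda>q. ?H (fst q)) has_derivative frechet_derivative ?H (at (fst q)) \<circ> fst) (at q)"
      by (simp add: o_def)
    then have "((\<lambda>q. Y q $ i) has_derivative frechet_derivative ?H (at (fst q)) \<circ> fst) (at q)"
      by (rule has_derivative_transform_within_open[OF _ D q]) (auto simp: Y_def g gfa i)
    then have "frechet_derivative (\<lambda>q. Y q $ i) (at q) h = frechet_derivative ?H (at (fst q)) 0"
      using frechet_derivative_at h comp_apply by metis
    also have "\<dots> = 0" using has_derivative_bounded_linear[OF H] bounded_linear.linear linear_0 by blast
    finally show ?thesis
      using frechet_derivative_vec_nth[OF smooth_on_differentiable[OF Y q]] by metis
  qed
  show ?thesis
    unfolding bracket_condition_def
  proof
    fix p assume p: "p \<in> D"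
    have df: "f differentiable (at q)" if "q \<in> D" for q using f that by (rule smooth_on_differentiable)
    have linf: "linear (frechet_derivative f (at p))" using df[OF p] by (rule linear_frechet_derivative)
    have linY: "linear (frechet_derivative Y (at p))" using Y p by (rule smooth_on_linear_deriv)
    have inj\<phi>: "inj (frechet_derivative \<phi> (at (f p)))" using W(2) p by (intro diffeo_on_inj_deriv[OF \<phi>]) auto
    have "lie_bracket v w p \<in> sum_dist input_dist (kernel_dist f) p"
      if "v \<in> sections D input_dist" "w \<in> sections D (kernel_dist f)" for v w
    proof -
      let ?\<xi> = "lie_bracket v w p"
      have v: "smooth_on D v" "\<And>q. q \<in> D \<Longrightarrow> fst (v q) = 0"
        using that(1) by (auto simp: sections_def input_dist_eq)
      have w: "smooth_on D w" "\<And>q. q \<in> D \<Longrightarrow> frechet_derivative f (at q) (w q) = 0"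
        using that(2) by (auto simp: sections_def kernel_dist_eq[OF df])
      \<comment> \<open>Such a component is annihilated by U because it does not vary with the
        input, and by K because it factors through \<open>f\<close>; hence the bracket annihilates
        it as well.\<close>
      have Y\<xi>: "frechet_derivative Y (at p) ?\<xi> $ i = 0" if i: "i \<notin> range \<beta>" for i
      proof -
        have comp: "frechet_derivative (\<lambda>q. Y q $ i) (at q) h = frechet_derivative Y (at q) h $ i"
          if "q \<in> D" for q h
          by (rule frechet_derivative_vec_nth[OF smooth_on_differentiable[OF Y that]])
        have "frechet_derivative (\<lambda>q. Y q $ i) (at p) ?\<xi> = 0"
        proof (rule lie_bracket_annihilates[OF D p _ v(1) w(1)])
          show "smooth_on D (\<lambda>q. Y q $ i)"
            by (rule smooth_on_bounded_linear_compose[OF D bounded_linear_vec_nth Y])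
          fix q assume q: "q \<in> D"
          show "frechet_derivative (\<lambda>q. Y q $ i) (at q) (v q) = 0"
            unfolding comp[OF q] by (rule dY_input[OF q v(2)[OF q] i])
          have "f q \<in> W" using q W(2) by auto
          then show "frechet_derivative (\<lambda>q. Y q $ i) (at q) (w q) = 0"
            unfolding comp[OF q] dY[OF q] w(2)[OF q]
            by (simp add: linear_0[OF smooth_on_linear_deriv[OF W'(2)]])
        qed
        then show ?thesis using comp[OF p] by metis
      qed
      \<comment> \<open>The input derivative of \<open>Y\<close> is concentrated in the components
        selected by \<open>\<beta>\<close>, so this square block inherits injectivity and is
        invertible. Solving with it produces an input direction having the same image as the
        bracket.\<close>
      define T where "T \<eta> = (\<chi> j. frechet_derivative Y (at p) (0, \<eta>) $ \<beta> j)" for \<eta> :: "real^'m"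
      have "linear T"
      proof (rule linearI)
        show "T (a + b) = T a + T b" for a b
          using linear_add[OF linY, of "(0, a)" "(0, b)"] by (simp add: T_def vec_eq_iff)
        show "T (c *\<^sub>R a) = c *\<^sub>R T a" for c a
          using linear_cmul[OF linY, of c "(0, a)"] by (simp add: T_def vec_eq_iff)
      qed
      moreover have "inj T"
        unfolding linear_injective_0[OF \<open>linear T\<close>]
      proof (intro allI impI)
        fix \<eta> assume "T \<eta> = 0"
        then have "frechet_derivative Y (at p) (0, \<eta>) $ \<beta> j = 0" for j by (simp add: T_def vec_eq_iff)
        moreover have "frechet_derivative Y (at p) (0, \<eta>) $ i = 0" if "i \<notin> range \<beta>" for i
          by (rule dY_input[OF p _ that]) simp
        ultimately have "frechet_derivative Y (at p) (0, \<eta>) = 0"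
          unfolding vec_eq_iff by (metis rangeE zero_index)
        then have "frechet_derivative \<phi> (at (f p)) (frechet_derivative f (at p) (0, \<eta>))
            = frechet_derivative \<phi> (at (f p)) 0"
          using dY[OF p, of 0] dY[OF p, of "(0, \<eta>)"] linear_0[OF linf] linear_0[OF linY] by simp
        then show "\<eta> = 0" using inj[OF p] injD[OF inj\<phi>] by blast
      qed
      ultimately have "surj T" using linear_injective_imp_surjective by blast
      then obtain \<eta> where \<eta>: "T \<eta> = (\<chi> j. frechet_derivative Y (at p) ?\<xi> $ \<beta> j)" by (metis surjD)
      have "frechet_derivative Y (at p) (0, \<eta>) $ i = frechet_derivative Y (at p) ?\<xi> $ i" for i
      proof (cases "i \<in> range \<beta>")
        case True
        then show ?thesis using \<eta> by (auto simp: T_def vec_eq_iff)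
      next
        case False
        then show ?thesis using Y\<xi> dY_input[OF p _ False, of "(0, \<eta>)"] by simp
      qed
      \<comment> \<open>Cancelling the injective derivative of \<open>\<phi>\<close> returns from
        \<open>Y\<close> to \<open>f\<close>.\<close>
      then have "frechet_derivative \<phi> (at (f p)) (frechet_derivative f (at p) ?\<xi>)
          = frechet_derivative \<phi> (at (f p)) (frechet_derivative f (at p) (0, \<eta>))"
        using dY[OF p] by (simp add: vec_eq_iff)
      then show ?thesis
        unfolding sum_dist_input_kernel_iff[OF df[OF p]] using injD[OF inj\<phi>] by blast
    qed
    then show "bracket_dist D input_dist (kernel_dist f) p \<subseteq> sum_dist input_dist (kernel_dist f) p"
      unfolding bracket_dist_def
      by (intro span_minimal subspace_sum_dist_input_kernel df p) auto
  qed
qed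

section \<open>Sufficiency\<close>

text \<open>The bracket condition concerns fields, but it will be exploited at a single kernel
  vector, which must therefore extend to a section of K. The extension is the orthogonal projection
  of the constant vector \<open>k0\<close> onto the kernel of \<open>?A q\<close>; surjectivity
  makes \<open>?G q\<close>, the product of \<open>?A q\<close> with its adjoint,
  invertible.\<close>

lemma kernel_section_through:
  fixes f :: "'a::euclidean_space \<Rightarrow> 'b::euclidean_space"
  assumes D: "open D" "p \<in> D" and f: "smooth_on D f"
    and surj: "\<And>q. q \<in> D \<Longrightarrow> surj (frechet_derivative f (at q))"
    and k0: "frechet_derivative f (at p) k0 = 0"
  obtains k where "smooth_on D k" "\<And>q. q \<in> D \<Longrightarrow> frechet_derivative f (at q) (k q) = 0" "k p = k0"
proof -
  let ?A = "\<lambda>q. frechet_derivative f (at q)"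
  let ?G = "\<lambda>q y. ?A q (adjoint (?A q) y)"
  have lin: "linear (?A q)" if "q \<in> D" for q using f that by (rule smooth_on_linear_deriv)
  have linT: "linear (adjoint (?A q))" if "q \<in> D" for q using lin[OF that] by (rule adjoint_linear)
  have linG: "linear (?G q)" if "q \<in> D" for q
    using linear_compose[OF linT[OF that] lin[OF that]] by (simp add: o_def)
  have smT: "smooth_on D (\<lambda>q. adjoint (?A q) y)" for y
  proof (rule smooth_on_cong[OF D(1)])
    show "(\<Sum>b\<in>Basis. (y \<bullet> ?A q b) *\<^sub>R b) = adjoint (?A q) y" if "q \<in> D" for q
      using euclidean_representation[of "adjoint (?A q) y"] adjoint_works[OF lin[OF that]]
      by (simp add: inner_commute)
    have "Ck_on k D (\<lambda>q. \<Sum>b\<in>Basis. (y \<bullet> ?A q b) *\<^sub>R b)" for k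
      by (intro Ck_on_sum D(1) Ck_on_bounded_linear_compose[OF D(1) bounded_linear_scaleR_left]
          Ck_on_bounded_linear_compose[OF D(1) bounded_linear_inner_right]
          smooth_on_Ck[OF smooth_on_frechet_derivative[OF f]])
    then show "smooth_on D (\<lambda>q. \<Sum>b\<in>Basis. (y \<bullet> ?A q b) *\<^sub>R b)" by (simp add: smooth_on_def)
  qed
  have smG: "smooth_on D (\<lambda>q. ?G q y)" for y
    by (rule smooth_on_linear_family_apply[OF D(1) lin smooth_on_frechet_derivative[OF f] smT])
  have injG: "inj (?G q)" if q: "q \<in> D" for q
    unfolding linear_injective_0[OF linG[OF q]]
  proof (intro allI impI)
    fix y assume "?G q y = 0"
    then have "y \<bullet> ?A q (adjoint (?A q) y) = 0" by simp
    then have "adjoint (?A q) y \<bullet> adjoint (?A q) y = 0"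
      using adjoint_works[OF lin[OF q], of "adjoint (?A q) y" y] by (simp add: inner_commute)
    then have "adjoint (?A q) y = adjoint (?A q) 0" using linear_0[OF linT[OF q]] by simp
    moreover have "inj (adjoint (?A q))" using surj[OF q] lin[OF q] by simp
    ultimately show "y = 0" by (metis injD)
  qed
  have bijG: "bij (?G q)" if "q \<in> D" for q
    using injG[OF that] linear_injective_imp_surjective[OF linG[OF that] injG[OF that]] by (simp add: bij_def)
  define k where "k q = k0 - adjoint (?A q) (inv (?G q) (?A q k0))" for q
  show thesis
  proof
    have sm: "smooth_on D (\<lambda>q. inv (?G q) (?A q k0))"
    proof (rule smooth_on_linear_family_apply[OF D(1) _ _ smooth_on_frechet_derivative[OF f]])
      show "linear (inv (?G q))" if "q \<in> D" for q using linG[OF that] bijG[OF that] by (rule linear_inv)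
      show "smooth_on D (\<lambda>q. inv (?G q) v)" for v
        by (rule smooth_on_inverse_linear_family[OF D(1) linG injG smG])
    qed
    have "smooth_on D (\<lambda>q. adjoint (?A q) (inv (?G q) (?A q k0)))"
      by (rule smooth_on_linear_family_apply[OF D(1) linT smT sm])
    then show "smooth_on D k"
      unfolding k_def by (intro smooth_on_diff smooth_on_const D(1))
  next
    fix q assume q: "q \<in> D"
    have "?G q (inv (?G q) (?A q k0)) = ?A q k0"
      using bijG[OF q] by (meson bij_is_surj surj_f_inv_f)
    then show "?A q (k q) = 0" unfolding k_def linear_diff[OF lin[OF q]] by simp
  next
    have "inv (?G p) 0 = 0"
      using linear_0[OF linear_inv[OF linG[OF D(2)] bijG[OF D(2)]]] .
    then show "k p = k0" unfolding k_def k0 using linear_0[OF linT[OF D(2)]] by simp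
  qed
qed

text \<open>Against a constant input field the bracket with \<open>k\<close> is the derivative of
  \<open>k\<close> in that input direction. Differentiating the kernel equation for \<open>k\<close>
  identifies its image, up to sign, with a mixed second derivative of \<open>f\<close>.\<close>

lemma second_derivative_in_input_image:
  fixes f :: "(real^'n) \<times> (real^'m) \<Rightarrow> real^'n"
  assumes D: "open D" "p \<in> D" and f: "smooth_on D f"
    and surj: "\<And>q. q \<in> D \<Longrightarrow> surj (frechet_derivative f (at q))"
    and bc: "bracket_condition D f" and k0: "frechet_derivative f (at p) k0 = 0"
  shows "\<exists>\<eta>'. frechet_derivative (\<lambda>q. frechet_derivative f (at q) (0, \<eta>)) (at p) k0
    = frechet_derivative f (at p) (0, \<eta>')"
proof -
  have df: "f differentiable (at q)" if "q \<in> D" for q using f that by (rule smooth_on_differentiable)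
  obtain k where k: "smooth_on D k" "\<And>q. q \<in> D \<Longrightarrow> frechet_derivative f (at q) (k q) = 0" "k p = k0"
    using kernel_section_through[OF D f surj k0] by blast
  let ?v = "\<lambda>q :: (real^'n) \<times> (real^'m). (0 :: real^'n, \<eta>)"
  have "k \<in> sections D (kernel_dist f)"
    using k(1,2) by (simp add: sections_def kernel_dist_eq[OF df])
  moreover have "?v \<in> sections D input_dist"
    by (simp add: sections_def input_dist_eq smooth_on_const D(1))
  ultimately have "lie_bracket ?v k p \<in> bracket_dist D input_dist (kernel_dist f) p"
    unfolding bracket_dist_def by (intro span_base) blast
  then have "lie_bracket ?v k p \<in> sum_dist input_dist (kernel_dist f) p"
    using bc D(2) unfolding bracket_condition_def by blast
  then obtain \<eta>' where \<eta>': "frechet_derivative f (at p) (frechet_derivative k (at p) (0, \<eta>))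
      = frechet_derivative f (at p) (0, \<eta>')"
    unfolding sum_dist_input_kernel_iff[OF df[OF D(2)]] lie_bracket_def by auto
  have "frechet_derivative (\<lambda>q. frechet_derivative f (at q) (0, \<eta>)) (at p) k0
      = - frechet_derivative f (at p) (0, \<eta>')"
    using derivative_along_annihilating_field[OF D f k(1,2), of "(0, \<eta>)"] \<eta>'
      second_derivative_symmetric[OF D f, of "(0, \<eta>)" k0] unfolding k(3) by simp
  also have "\<dots> = frechet_derivative f (at p) (0, - \<eta>')"
    using linear_neg[OF smooth_on_linear_deriv[OF f D(2)], of "(0, \<eta>')"] by simp
  finally show ?thesis by blast
qed

text \<open>Row rank equals column rank: a basis of the row space chosen among the rows has as many
  elements as there are inputs, hence spans the input space, and a vector orthogonal to all of it is
  zero.\<close>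

lemma injective_linear_selects_coordinates:
  fixes V :: "real^'m \<Rightarrow> real^'n"
  assumes "linear V" "inj V"
  obtains \<beta> :: "'m \<Rightarrow> 'n" where "inj \<beta>" "\<And>\<eta>. (\<And>j. V \<eta> $ \<beta> j = 0) \<Longrightarrow> \<eta> = 0"
proof -
  let ?A = "matrix V"
  have A: "?A *v \<eta> = V \<eta>" for \<eta> using assms(1) by (simp add: matrix_works)
  then have "inj ((*v) ?A)" using assms(2) by (simp add: inj_def)
  then have "dim (rows ?A) = CARD('m)"
    using full_rank_injective[of ?A] by (simp add: row_rank_def)
  moreover obtain B where B: "B \<subseteq> rows ?A" "independent B" "rows ?A \<subseteq> span B" "card B = dim (rows ?A)"
    using basis_exists by blast
  ultimately have cardB: "card B = CARD('m)" by simp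
  have finB: "finite B" using B(2) by (rule independent_imp_finite)
  have spanB: "span B = UNIV"
  proof -
    have "dim B = DIM(real^'m)" using cardB dim_eq_card_independent[OF B(2)] by simp
    then show ?thesis using dim_eq_full by blast
  qed
  obtain h where h: "bij_betw h (UNIV :: 'm set) B"
    using finite_same_card_bij[OF finite finB] cardB by auto
  have "\<exists>i. h j = row i ?A" for j
    using B(1) bij_betw_apply[OF h, of j] by (auto simp: rows_def)
  then obtain \<beta> where \<beta>: "\<And>j. h j = row (\<beta> j) ?A" by metis
  show thesis
  proof
    show "inj \<beta>" using h \<beta> by (metis bij_betw_imp_inj_on injD injI)
    fix \<eta> assume z: "\<And>j. V \<eta> $ \<beta> j = 0"
    have "orthogonal \<eta> b" if "b \<in> B" for b
    proof -
      obtain j where "b = h j" using h \<open>b \<in> B\<close> by (metis bij_betw_imp_surj_on imageE)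
      then have "b \<bullet> \<eta> = V \<eta> $ \<beta> j"
        using A[of \<eta>] \<beta>[of j] by (metis matrix_vector_mul_component row_def vec_nth_inverse)
      then show ?thesis using z by (simp add: orthogonal_def inner_commute)
    qed
    then have "orthogonal \<eta> \<eta>" using orthogonal_to_span[of \<eta> B \<eta>] spanB by auto
    then show "\<eta> = 0" by (simp add: orthogonal_self)
  qed
qed

section \<open>Extending a local chart to a second base point\<close>

lemma diffeo_on_disjoint_Un:
  assumes \<phi>: "diffeo_on S \<phi>" and \<rho>: "diffeo_on T \<rho>" and disj: "S \<inter> T = {}" "\<phi> ` S \<inter> \<rho> ` T = {}"
  shows "diffeo_on (S \<union> T) (\<lambda>x. if x \<in> S then \<phi> x else \<rho> x)" (is "diffeo_on _ ?\<theta>")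
proof -
  obtain \<psi> where \<psi>: "smooth_on (\<phi> ` S) \<psi>" "\<And>x. x \<in> S \<Longrightarrow> \<psi> (\<phi> x) = x"
    and S: "open (\<phi> ` S)" "smooth_on S \<phi>" "open S"
    using \<phi> unfolding diffeo_on_def by blast
  obtain \<omega> where \<omega>: "smooth_on (\<rho> ` T) \<omega>" "\<And>x. x \<in> T \<Longrightarrow> \<omega> (\<rho> x) = x"
    and T: "open (\<rho> ` T)" "smooth_on T \<rho>" "open T"
    using \<rho> unfolding diffeo_on_def by blast
  have im: "?\<theta> ` (S \<union> T) = \<phi> ` S \<union> \<rho> ` T" using disj(1) by (auto simp: image_def)
  let ?\<kappa> = "\<lambda>y. if y \<in> \<phi> ` S then \<psi> y else \<omega> y"
  have "smooth_on S ?\<theta>" by (rule smooth_on_cong[OF S(3) _ S(2)]) simp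
  moreover have "smooth_on T ?\<theta>" by (rule smooth_on_cong[OF T(3) _ T(2)]) (use disj(1) in auto)
  moreover have "smooth_on (\<phi> ` S) ?\<kappa>" by (rule smooth_on_cong[OF S(1) _ \<psi>(1)]) simp
  moreover have "smooth_on (\<rho> ` T) ?\<kappa>" by (rule smooth_on_cong[OF T(1) _ \<omega>(1)]) (use disj(2) in auto)
  moreover have "?\<kappa> (?\<theta> x) = x" if "x \<in> S \<union> T" for x
    using that disj \<psi>(2) \<omega>(2) by auto
  ultimately show ?thesis
    unfolding diffeo_on_def im using S T by (blast intro: smooth_on_Un)
qed

lemma diffeo_on_translation:
  assumes "open S"
  shows "diffeo_on S (\<lambda>x. x + c)"
  unfolding diffeo_on_def
proof (intro conjI exI ballI)
  have "(\<lambda>x. x + c) ` S = (+) c ` S" by (simp add: add.commute)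
  then show op: "open ((\<lambda>x. x + c) ` S)" using open_translation[OF assms] by simp
  show "smooth_on S (\<lambda>x. x + c)" by (intro smooth_on_add smooth_on_id smooth_on_const assms)
  show "smooth_on ((\<lambda>x. x + c) ` S) (\<lambda>y. y - c)"
    by (intro smooth_on_diff smooth_on_id smooth_on_const op)
qed (use assms in auto)

text \<open>One map has to act on current and on shifted states, while \<open>G\<close> is a chart
  around the shifted state \<open>x1\<close> only. If \<open>x0\<close> lies outside its domain, a
  translated neighbourhood of \<open>x0\<close> is added whose image avoids that of
  \<open>G\<close>; boundedness of the latter leaves room for it.\<close>

lemma diffeo_on_extend_to_point:
  fixes G :: "'a::euclidean_space \<Rightarrow> 'a"
  assumes G: "diffeo_on W1 G" "x1 \<in> W1" "W1 \<subseteq> X" "G ` W1 \<subseteq> ball 0 1" and X: "open X" "x0 \<in> X"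
  obtains W \<phi> W2 where "W \<subseteq> X" "diffeo_on W \<phi>" "x0 \<in> W" "x1 \<in> W2" "open W2" "W2 \<subseteq> W" "W2 \<subseteq> W1"
    "\<forall>y\<in>W2. \<phi> y = G y"
proof (cases "x0 \<in> W1")
  case True
  have "open W1" using G(1) by (simp add: diffeo_on_def)
  with True G that[of W1 G W1] show thesis by blast
next
  case False
  have oW1: "open W1" using G(1) by (simp add: diffeo_on_def)
  have ne: "x0 \<noteq> x1" using False G(2) by blast
  define r where "r = dist x0 x1 / 2"
  have r: "r > 0" using ne by (simp add: r_def)
  obtain e :: 'a where e: "norm e = 1" by (metis nonempty_Basis ex_in_conv norm_Basis)
  \<comment> \<open>The translation sends \<open>x0\<close> to norm \<open>1 + r\<close>, so the
    ball of radius \<open>r\<close> around \<open>x0\<close> lands outside the unit ball. Half the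
    distance as \<open>r\<close> keeps the balls around \<open>x0\<close> and \<open>x1\<close>
    disjoint.\<close>
  define c where "c = (1 + r) *\<^sub>R e - x0"
  define W0 where "W0 = X \<inter> ball x0 r"
  define W2 where "W2 = W1 \<inter> ball x1 r"
  have W0: "open W0" "x0 \<in> W0" using X r by (auto simp: W0_def)
  have W2: "open W2" "x1 \<in> W2" "W2 \<subseteq> W1" using oW1 G(2) r by (auto simp: W2_def)
  have "ball x0 r \<inter> ball x1 r = {}"
    by (rule disjoint_ballI) (simp add: r_def)
  then have disj: "W0 \<inter> W2 = {}" by (auto simp: W0_def W2_def)
  have "x + c \<notin> ball 0 1" if "x \<in> W0" for x
  proof -
    have "norm (x - x0) < r" using that by (simp add: W0_def dist_norm norm_minus_commute)
    moreover have "norm ((1 + r) *\<^sub>R e) = 1 + r" using e r by simp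
    moreover have "norm ((1 + r) *\<^sub>R e) \<le> norm (x + c) + norm (x - x0)"
      using norm_triangle_ineq4[of "x + c" "x - x0"] by (simp add: c_def)
    ultimately show ?thesis by simp
  qed
  then have disj': "(\<lambda>x. x + c) ` W0 \<inter> G ` W2 = {}" using G(4) W2(3) by blast
  show thesis
  proof (rule that[of "W0 \<union> W2" "\<lambda>x. if x \<in> W0 then x + c else G x" W2])
    show "diffeo_on (W0 \<union> W2) (\<lambda>x. if x \<in> W0 then x + c else G x)"
      by (rule diffeo_on_disjoint_Un[OF diffeo_on_translation[OF W0(1)]
            diffeo_on_subset[OF G(1) W2(1,3)] disj disj'])
  qed (use W0 W2 disj G(3) in \<open>auto simp: W0_def\<close>)
qed

section \<open>The image of the input directions along the fibres of \<open>f\<close>\<close>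

lemma linear_select_coordinates: "linear (\<lambda>z :: real^'n. \<chi> j. z $ \<beta> j)"
  by (rule linearI) (auto simp: vec_eq_iff)

text \<open>A frame of the image, normalised in the coordinates \<open>\<beta>\<close>, has zero
  derivative in kernel directions. On a neighbourhood where fibres become affine slices of a ball it
  is therefore constant on each fibre.\<close>

lemma input_image_constant_on_fibres:
  fixes f :: "(real^'n) \<times> (real^'m) \<Rightarrow> real^'n" and \<beta> :: "'m \<Rightarrow> 'n"
  assumes D: "open D" "p0 \<in> D" and f: "smooth_on D f"
    and surj: "\<And>q. q \<in> D \<Longrightarrow> surj (frechet_derivative f (at q))"
    and bc: "bracket_condition D f"
    and \<beta>: "\<And>\<eta>. (\<And>j. frechet_derivative f (at p0) (0, \<eta>) $ \<beta> j = 0) \<Longrightarrow> \<eta> = 0"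
  obtains N where "open N" "p0 \<in> N" "N \<subseteq> D"
    "\<And>p q \<eta>. p \<in> N \<Longrightarrow> q \<in> N \<Longrightarrow> f p = f q \<Longrightarrow>
       \<exists>\<eta>'. frechet_derivative f (at p) (0, \<eta>) = frechet_derivative f (at q) (0, \<eta>')"
proof -
  let ?A = "\<lambda>q. frechet_derivative f (at q)"
  define P :: "real^'n \<Rightarrow> real^'m" where "P z = (\<chi> j. z $ \<beta> j)" for z
  have linP: "linear P" unfolding P_def by (rule linear_select_coordinates)
  have blP: "bounded_linear P" using linP by (simp add: linear_conv_bounded_linear)
  have lin: "linear (?A q)" if "q \<in> D" for q using f that by (rule smooth_on_linear_deriv)
  \<comment> \<open>The derivative of \<open>H\<close> is injective exactly where the square block
    of the input derivative is. The inverse function theorem spreads this from \<open>p0\<close> to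
    the neighbourhood \<open>N1\<close>.\<close>
  define H where "H q = (fst q, P (f q))" for q
  have H: "smooth_on D H"
    unfolding H_def by (intro smooth_on_Pair D(1) smooth_on_bounded_linear_compose[OF D(1) bounded_linear_fst]
        smooth_on_id smooth_on_bounded_linear_compose[OF D(1) blP f])
  have dH: "frechet_derivative H (at q) h = (fst h, P (?A q h))" if "q \<in> D" for q h
  proof -
    have "(H has_derivative (\<lambda>h. (fst h, P (?A q h)))) (at q)"
      unfolding H_def
      by (intro has_derivative_Pair bounded_linear.has_derivative[OF bounded_linear_fst] has_derivative_ident
          bounded_linear.has_derivative[OF blP] smooth_on_has_derivative[OF f that])
    from frechet_derivative_at[OF this, symmetric] show ?thesis by (rule fun_cong)
  qed
  have "inj (frechet_derivative H (at p0))"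
    unfolding linear_injective_0[OF smooth_on_linear_deriv[OF H D(2)]] dH[OF D(2)]
  proof (intro allI impI)
    fix h assume h: "(fst h, P (?A p0 h)) = 0"
    then have h0: "h = (0, snd h)" by (simp add: prod_eq_iff)
    have "P (?A p0 h) = 0" using h by (simp add: prod_eq_iff)
    then have "P (?A p0 (0, snd h)) = 0" using h0 by metis
    then have "?A p0 (0, snd h) $ \<beta> j = 0" for j by (simp add: P_def vec_eq_iff)
    then have "snd h = 0" by (rule \<beta>)
    with h0 show "h = 0" by (simp add: prod_eq_iff)
  qed
  then obtain N1 where N1: "p0 \<in> N1" "N1 \<subseteq> D" "diffeo_on N1 H"
    using smooth_inverse_function_theorem[OF D H] by blast
  have oN1: "open N1" using N1(3) by (simp add: diffeo_on_def)
  have fN1: "smooth_on N1 f" using f N1(2) by (rule smooth_on_subset)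
  define Q where "Q q \<eta> = P (?A q (0, \<eta>))" for q \<eta>
  have linQ: "linear (Q q)" if "q \<in> N1" for q
  proof -
    have q: "q \<in> D" using that N1 by blast
    show ?thesis
    proof (rule linearI)
      show "Q q (a + b) = Q q a + Q q b" for a b
        using linear_add[OF lin[OF q], of "(0, a)" "(0, b)"] linear_add[OF linP] by (simp add: Q_def)
      show "Q q (c *\<^sub>R a) = c *\<^sub>R Q q a" for c a
        using linear_cmul[OF lin[OF q], of c "(0, a)"] linear_cmul[OF linP] by (simp add: Q_def)
    qed
  qed
  have injQ: "inj (Q q)" if "q \<in> N1" for q
    unfolding linear_injective_0[OF linQ[OF that]]
  proof (intro allI impI)
    fix \<eta> assume "Q q \<eta> = 0"
    have q: "q \<in> D" using that N1 by blast
    have "frechet_derivative H (at q) (0, \<eta>) = frechet_derivative H (at q) (0, 0)"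
      using \<open>Q q \<eta> = 0\<close> linear_0[OF lin[OF q]] linear_0[OF linP]
      by (simp add: dH[OF q] Q_def zero_prod_def[symmetric])
    then show "\<eta> = 0" using diffeo_on_inj_deriv[OF N1(3) that] by (auto dest: injD)
  qed
  have bijQ: "bij (Q q)" if "q \<in> N1" for q
    using injQ[OF that] linear_injective_imp_surjective[OF linQ[OF that] injQ[OF that]] by (simp add: bij_def)
  have smQ: "smooth_on N1 (\<lambda>q. Q q \<eta>)" for \<eta>
    unfolding Q_def
    by (rule smooth_on_bounded_linear_compose[OF oN1 blP smooth_on_frechet_derivative[OF fN1]])
  \<comment> \<open>This input field is tuned so that its image \<open>m \<eta>\<close> has the
    constant \<open>\<beta>\<close>-components \<open>\<eta>\<close>; letting \<open>\<eta>\<close>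
    vary yields the normalised frame.\<close>
  define w where "w \<eta> q = (0 :: real^'n, inv (Q q) \<eta>)" for \<eta> q
  have w: "smooth_on N1 (w \<eta>)" for \<eta>
    unfolding w_def
    by (intro smooth_on_Pair oN1 smooth_on_const smooth_on_inverse_linear_family linQ injQ smQ)
  define m where "m \<eta> q = ?A q (w \<eta> q)" for \<eta> q
  have m: "smooth_on N1 (m \<eta>)" for \<eta>
    unfolding m_def
    by (rule smooth_on_linear_family_apply[OF oN1 smooth_on_linear_deriv[OF fN1]
          smooth_on_frechet_derivative[OF fN1] w])
  have Pm: "P (m \<eta> q) = \<eta>" if "q \<in> N1" for \<eta> q
    using surj_f_inv_f[OF bij_is_surj[OF bijQ[OF that]], of \<eta>] by (simp add: m_def w_def Q_def)
  \<comment> \<open>The product rule gives a second derivative of \<open>f\<close>, in the input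
    image by the bracket condition, plus the image of the derivative of \<open>w\<close>, again an
    input vector. The sum is the image of some \<open>\<zeta>\<close>; as
    \<open>P (m \<eta> q)\<close> is constant, \<open>Q q \<zeta> = 0\<close> and so
    \<open>\<zeta> = 0\<close>.\<close>
  have dm: "frechet_derivative (m \<eta>) (at q) k = 0" if q: "q \<in> N1" and k: "?A q k = 0" for \<eta> q k
  proof -
    have qD: "q \<in> D" using q N1 by blast
    define s where "s = snd (frechet_derivative (w \<eta>) (at q) k)"
    have sum: "frechet_derivative (m \<eta>) (at q) k
        = frechet_derivative (\<lambda>x. ?A x (w \<eta> q)) (at q) k + ?A q (frechet_derivative (w \<eta>) (at q) k)"
      using fun_cong[OF frechet_derivative_at[OF derivative_along_field_has_derivative[OF oN1 q fN1 w[of \<eta>]],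
          symmetric], of k] by (simp add: m_def[abs_def])
    obtain \<eta>' where \<eta>': "frechet_derivative (\<lambda>x. ?A x (w \<eta> q)) (at q) k = ?A q (0, \<eta>')"
      using second_derivative_in_input_image[OF D(1) qD f surj bc k] unfolding w_def by blast
    have dw: "frechet_derivative (w \<eta>) (at q) k = (0, s)"
    proof -
      have "((\<lambda>x. fst (w \<eta> x)) has_derivative (\<lambda>k. fst (frechet_derivative (w \<eta>) (at q) k))) (at q)"
        by (rule bounded_linear.has_derivative[OF bounded_linear_fst smooth_on_has_derivative[OF w q]])
      moreover have "(\<lambda>x. fst (w \<eta> x)) = (\<lambda>x. 0)" by (simp add: w_def)
      ultimately have fst0: "(\<lambda>k. fst (frechet_derivative (w \<eta>) (at q) k)) = (\<lambda>k. 0)"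
        using has_derivative_unique[OF _ has_derivative_const] by metis
      show ?thesis using fun_cong[OF fst0, of k] by (simp add: s_def prod_eq_iff)
    qed
    define \<zeta> where "\<zeta> = \<eta>' + s"
    have \<zeta>: "frechet_derivative (m \<eta>) (at q) k = ?A q (0, \<zeta>)"
      unfolding sum \<eta>' dw using linear_add[OF lin[OF qD], of "(0, \<eta>')" "(0, s)"] by (simp add: \<zeta>_def)
    have "((\<lambda>x. P (m \<eta> x)) has_derivative (\<lambda>k. P (frechet_derivative (m \<eta>) (at q) k))) (at q)"
      by (rule bounded_linear.has_derivative[OF blP smooth_on_has_derivative[OF m q]])
    then have "((\<lambda>x. \<eta>) has_derivative (\<lambda>k. P (frechet_derivative (m \<eta>) (at q) k))) (at q)"
      by (rule has_derivative_transform_within_open[OF _ oN1 q]) (rule Pm)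
    from fun_cong[OF has_derivative_unique[OF this has_derivative_const], of k]
    have "Q q \<zeta> = 0" by (simp add: \<zeta> Q_def)
    then have "\<zeta> = 0" using injQ[OF q] linear_0[OF linQ[OF q]] by (metis injD)
    then show ?thesis using \<zeta> linear_0[OF lin[OF qD]] by (simp add: zero_prod_def[symmetric])
  qed
  obtain R where R: "linear R" "?A p0 \<circ> R = id"
    using linear_surjective_right_inverse[OF lin[OF D(2)] surj[OF D(2)]] by blast
  have AR: "?A p0 (R z) = z" for z using fun_cong[OF R(2), of z] by simp
  \<comment> \<open>A local chart in which \<open>f\<close> is the affine map given by its derivative at \<open>p0\<close>.\<close>
  define \<Theta> where "\<Theta> p = p + R (f p - f p0 - ?A p0 (p - p0))" for p
  have blR: "bounded_linear R" using R(1) by (simp add: linear_conv_bounded_linear)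
  have blA: "bounded_linear (?A p0)" using lin[OF D(2)] by (simp add: linear_conv_bounded_linear)
  have \<Theta>: "smooth_on N1 \<Theta>"
    unfolding \<Theta>_def
    by (intro smooth_on_add smooth_on_id oN1 smooth_on_bounded_linear_compose[OF oN1 blR]
        smooth_on_diff fN1 smooth_on_const smooth_on_bounded_linear_compose[OF oN1 blA])
  have f\<Theta>: "f p = ?A p0 (\<Theta> p) + (f p0 - ?A p0 p0)" for p
    unfolding \<Theta>_def by (simp add: linear_add[OF lin[OF D(2)]] AR linear_diff[OF lin[OF D(2)]])
  have "(\<Theta> has_derivative (\<lambda>h. h + R (?A p0 h - 0 - ?A p0 (h - 0)))) (at p0)"
    unfolding \<Theta>_def
    by (intro has_derivative_add has_derivative_diff has_derivative_ident has_derivative_const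
        bounded_linear.has_derivative[OF blR] bounded_linear.has_derivative[OF blA]
        smooth_on_has_derivative[OF f D(2)])
  then have "(\<Theta> has_derivative (\<lambda>h. h)) (at p0)" by (simp add: linear_0[OF R(1)])
  from frechet_derivative_at[OF this] have "inj (frechet_derivative \<Theta> (at p0))" by (metis inj_on_id2)
  then obtain N2 where N2: "p0 \<in> N2" "N2 \<subseteq> N1" "diffeo_on N2 \<Theta>"
    using smooth_inverse_function_theorem[OF oN1 N1(1) \<Theta>] by blast
  obtain \<psi> where \<psi>: "smooth_on (\<Theta> ` N2) \<psi>" "\<And>x. x \<in> N2 \<Longrightarrow> \<psi> (\<Theta> x) = x" "open (\<Theta> ` N2)" "open N2"
    using N2(3) unfolding diffeo_on_def by blast
  obtain r where r: "r > 0" "ball (\<Theta> p0) r \<subseteq> \<Theta> ` N2"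
    using \<psi>(3) N2(1) openE by blast
  \<comment> \<open>In the chart \<open>\<Theta>\<close> the points of \<open>N\<close> fill a ball,
    so two of them can be joined by a segment inside the chart.\<close>
  define N where "N = N2 \<inter> \<Theta> -` ball (\<Theta> p0) r"
  have "continuous_on N2 \<Theta>" using smooth_on_continuous[OF \<Theta>] N2(2) continuous_on_subset by blast
  then have oN: "open N" unfolding N_def using continuous_open_preimage[OF _ \<psi>(4) open_ball] by blast
  \<comment> \<open>Since \<open>f\<close> is affine in the chart, the derivative of
    \<open>\<psi>\<close> carries the kernel at \<open>p0\<close> into the kernel at
    \<open>\<psi> z\<close>.\<close>
  have d\<psi>: "?A (\<psi> z) (frechet_derivative \<psi> (at z) h) = ?A p0 h" if z: "z \<in> \<Theta> ` N2" for z h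
  proof -
    have "\<psi> z \<in> D" using z \<psi>(2) N2(2) N1(2) by auto
    from diff_chain_at[OF smooth_on_has_derivative[OF \<psi>(1) z] smooth_on_has_derivative[OF f this]]
    have "((\<lambda>z. f (\<psi> z)) has_derivative (\<lambda>h. ?A (\<psi> z) (frechet_derivative \<psi> (at z) h))) (at z)"
      by (simp add: o_def)
    then have 1: "((\<lambda>z. ?A p0 z + (f p0 - ?A p0 p0)) has_derivative
        (\<lambda>h. ?A (\<psi> z) (frechet_derivative \<psi> (at z) h))) (at z)"
    proof (rule has_derivative_transform_within_open[OF _ \<psi>(3) z])
      fix z' assume "z' \<in> \<Theta> ` N2"
      then show "f (\<psi> z') = ?A p0 z' + (f p0 - ?A p0 p0)" using f\<Theta>[of "\<psi> z'"] \<psi>(2) by auto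
    qed
    have 2: "((\<lambda>z. ?A p0 z + (f p0 - ?A p0 p0)) has_derivative (\<lambda>h. ?A p0 h + 0)) (at z)"
      by (intro has_derivative_add has_derivative_const bounded_linear.has_derivative[OF blA] has_derivative_ident)
    show ?thesis using fun_cong[OF has_derivative_unique[OF 1 2], of h] by simp
  qed
  have m_eq: "m \<eta> p = m \<eta> q" if p: "p \<in> N" and q: "q \<in> N" and eq: "f p = f q" for p q \<eta>
  proof -
    let ?a = "\<Theta> p" let ?d = "\<Theta> q - \<Theta> p"
    let ?c = "\<lambda>t. ?a + t *\<^sub>R ?d"
    have Ad: "?A p0 ?d = 0"
      using eq f\<Theta>[of p] f\<Theta>[of q] by (simp add: linear_diff[OF lin[OF D(2)]])
    have c: "?c t \<in> \<Theta> ` N2" if t: "t \<in> {0..1}" for t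
    proof -
      have "?c t = (1 - t) *\<^sub>R \<Theta> p + t *\<^sub>R \<Theta> q" by (simp add: algebra_simps)
      also have "\<dots> \<in> ball (\<Theta> p0) r"
        using convex_ball[of "\<Theta> p0" r] p q t unfolding convex_alt N_def by auto
      finally show ?thesis using r(2) by blast
    qed
    \<comment> \<open>Equal values of \<open>f\<close> put the segment's direction into the kernel
      at \<open>p0\<close>; its image under \<open>\<psi>\<close> thus moves within a fibre, along
      which \<open>m \<eta>\<close> has zero derivative.\<close>
    have "m \<eta> (\<psi> (?c 0)) = m \<eta> (\<psi> (?c 1))"
    proof (rule has_derivative_zero_unique[of "{0..1}" "\<lambda>t. m \<eta> (\<psi> (?c t))" 0 1])
      fix t :: real assume t: "t \<in> {0..1}"
      have z: "?c t \<in> \<Theta> ` N2" using c[OF t] .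
      have \<psi>z: "\<psi> (?c t) \<in> N1" using z \<psi>(2) N2(2) by auto
      have "(?c has_derivative (\<lambda>h. h *\<^sub>R ?d)) (at t)" by (auto intro!: derivative_eq_intros)
      from diff_chain_at[OF this smooth_on_has_derivative[OF \<psi>(1) z]]
      have "((\<lambda>t. \<psi> (?c t)) has_derivative (\<lambda>h. frechet_derivative \<psi> (at (?c t)) (h *\<^sub>R ?d))) (at t)"
        by (simp only: o_def)
      from diff_chain_at[OF this smooth_on_has_derivative[OF m[of \<eta>] \<psi>z]]
      have "((\<lambda>t. m \<eta> (\<psi> (?c t))) has_derivative
          (\<lambda>h. frechet_derivative (m \<eta>) (at (\<psi> (?c t))) (frechet_derivative \<psi> (at (?c t)) (h *\<^sub>R ?d)))) (at t)"
        by (simp only: o_def)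
      moreover have "frechet_derivative (m \<eta>) (at (\<psi> (?c t))) (frechet_derivative \<psi> (at (?c t)) (h *\<^sub>R ?d)) = 0" for h
        by (rule dm[OF \<psi>z]) (simp add: d\<psi>[OF z] linear_cmul[OF lin[OF D(2)]] Ad)
      ultimately show "((\<lambda>t. m \<eta> (\<psi> (?c t))) has_derivative (\<lambda>h. 0)) (at t within {0..1})"
        by (simp add: has_derivative_at_withinI)
    qed auto
    then show ?thesis using p q \<psi>(2) by (simp add: N_def)
  qed
  show thesis
  proof
    show "open N" by (rule oN)
    show "p0 \<in> N" using N2(1) r by (simp add: N_def)
    show "N \<subseteq> D" using N2(2) N1(2) by (auto simp: N_def)
    fix p q \<eta> assume p: "p \<in> N" and q: "q \<in> N" and eq: "f p = f q"
    have "p \<in> N1" using p N2(2) by (auto simp: N_def)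
    then have "inv (Q p) (Q p \<eta>) = \<eta>" using injQ by (simp add: inv_f_f)
    then have "?A p (0, \<eta>) = m (Q p \<eta>) p" by (simp add: m_def w_def)
    also have "\<dots> = m (Q p \<eta>) q" using m_eq[OF p q eq] .
    finally show "\<exists>\<eta>'. ?A p (0, \<eta>) = ?A q (0, \<eta>')" by (auto simp: m_def w_def)
  qed
qed

section \<open>Construction of the transformation\<close>

lemma transformable_if_bracket_condition:
  fixes f :: "(real^'n) \<times> (real^'m) \<Rightarrow> real^'n"
  assumes D: "open D" "p0 \<in> D" and f: "smooth_on D f" and X: "open X" "fst ` D \<subseteq> X" "f ` D \<subseteq> X"
    and surj: "\<And>q. q \<in> D \<Longrightarrow> surj (frechet_derivative f (at q))"
    and inj: "\<And>\<eta>. frechet_derivative f (at p0) (0, \<eta>) = 0 \<Longrightarrow> \<eta> = 0"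
    and bc: "bracket_condition D f"
  shows "\<exists>D'. open D' \<and> p0 \<in> D' \<and> D' \<subseteq> D \<and> transformable_on X D' f decomposed_form"
proof -
  let ?A = "\<lambda>q. frechet_derivative f (at q)"
  have lin: "linear (?A q)" if "q \<in> D" for q using f that by (rule smooth_on_linear_deriv)
  have linV: "linear (\<lambda>\<eta>. ?A p0 (0, \<eta>))"
  proof (rule linearI)
    show "?A p0 (0, a + b) = ?A p0 (0, a) + ?A p0 (0, b)" for a b
      using linear_add[OF lin[OF D(2)], of "(0, a)" "(0, b)"] by simp
    show "?A p0 (0, c *\<^sub>R a) = c *\<^sub>R ?A p0 (0, a)" for c a
      using linear_cmul[OF lin[OF D(2)], of c "(0, a)"] by simp
  qed
  then have "inj (\<lambda>\<eta>. ?A p0 (0, \<eta>))" unfolding linear_injective_0[OF linV] using inj by blast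
  with linV obtain \<beta> :: "'m \<Rightarrow> 'n" where \<beta>: "inj \<beta>"
    "\<And>\<eta>. (\<And>j. ?A p0 (0, \<eta>) $ \<beta> j = 0) \<Longrightarrow> \<eta> = 0"
    by (rule injective_linear_selects_coordinates) blast
  obtain N where N: "open N" "p0 \<in> N" "N \<subseteq> D"
    and fibre: "\<And>p q \<eta>. p \<in> N \<Longrightarrow> q \<in> N \<Longrightarrow> f p = f q \<Longrightarrow> \<exists>\<eta>'. ?A p (0, \<eta>) = ?A q (0, \<eta>')"
    using input_image_constant_on_fibres[OF D f surj bc \<beta>(2)] by blast
  \<comment> \<open>\<open>P\<close> reads off the b-components, \<open>J\<close> inserts them, and
    \<open>C\<close> projects onto the a-components, so that \<open>z\<close> is the sum of
    \<open>J (P z)\<close> and \<open>C z\<close>.\<close>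
  define P :: "real^'n \<Rightarrow> real^'m" where "P z = (\<chi> j. z $ \<beta> j)" for z
  define J :: "real^'m \<Rightarrow> real^'n" where "J \<eta> = (\<chi> i. if i \<in> range \<beta> then \<eta> $ inv \<beta> i else 0)" for \<eta>
  define C :: "real^'n \<Rightarrow> real^'n" where "C z = (\<chi> i. if i \<in> range \<beta> then 0 else z $ i)" for z
  have linP: "linear P" unfolding P_def by (rule linear_select_coordinates)
  have blP: "bounded_linear P" using linP by (simp add: linear_conv_bounded_linear)
  have linC: "linear C" by (rule linearI) (auto simp: C_def vec_eq_iff)
  have PJ: "P (J \<eta>) = \<eta>" for \<eta> using \<beta>(1) by (simp add: P_def J_def vec_eq_iff)
  have CJ: "C (J \<eta>) = 0" for \<eta> by (simp add: C_def J_def vec_eq_iff)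
  obtain R where R: "linear R" "?A p0 \<circ> R = id"
    using linear_surjective_right_inverse[OF lin[OF D(2)] surj[OF D(2)]] by blast
  have AR: "?A p0 (R z) = z" for z using fun_cong[OF R(2), of z] by simp
  \<comment> \<open>The a-components move the state through a right inverse of the differential, and
    the b-components move the input. Discarding the input part of \<open>R (C z)\<close> changes the
    image only within the input image.\<close>
  define L where "L z = (fst (R (C z)), P z)" for z
  have linL: "linear L"
    by (rule linearI) (auto simp: L_def linear_add[OF R(1)] linear_add[OF linC] linear_add[OF linP]
        linear_cmul[OF R(1)] linear_cmul[OF linC] linear_cmul[OF linP])
  have blL: "bounded_linear L" using linL by (simp add: linear_conv_bounded_linear)
  have LJ: "L (J \<eta>) = (0, \<eta>)" for \<eta> by (simp add: L_def PJ CJ linear_0[OF R(1)])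
  define \<sigma> where "\<sigma> z = p0 + L z" for z
  have \<sigma>0: "\<sigma> 0 = p0" by (simp add: \<sigma>_def linear_0[OF linL])
  have \<sigma>': "(\<sigma> has_derivative L) (at z)" for z
    unfolding \<sigma>_def
    using has_derivative_add[OF has_derivative_const[of p0] bounded_linear.has_derivative[OF blL has_derivative_ident]]
    by simp
  \<comment> \<open>The unit ball bounds the values of the later chart \<open>G\<close>, as its
    extension to \<open>fst p0\<close> requires.\<close>
  define S where "S = \<sigma> -` N \<inter> ball 0 1"
  have "continuous_on UNIV \<sigma>" using \<sigma>' by (auto intro: continuous_at_imp_continuous_on has_derivative_continuous)
  then have S: "open S" "0 \<in> S"
    using N(1,2) \<sigma>0 by (auto simp: S_def intro!: open_Int open_vimage)
  \<comment> \<open>The \<open>b\<close>-coordinate lines of \<open>F\<close> run in the orbits \<open>u \<mapsto> f (x, u)\<close>, which are the leaves of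
    the image of the input distribution; the \<open>a\<close>-coordinates parametrise a transversal.\<close>
  define F where "F z = f (\<sigma> z)" for z
  have F: "smooth_on S F"
    unfolding F_def
  proof (rule smooth_on_compose[OF S(1) N(1) _ _ smooth_on_subset[OF f N(3)]])
    show "smooth_on S \<sigma>"
      unfolding \<sigma>_def
      by (intro smooth_on_add smooth_on_const S(1) smooth_on_bounded_linear_compose[OF S(1) blL] smooth_on_id)
  qed (auto simp: S_def)
  have dF: "frechet_derivative F (at z) h = ?A (\<sigma> z) (L h)" if "z \<in> S" for z h
  proof -
    have "\<sigma> z \<in> D" using that N(3) by (auto simp: S_def)
    from diff_chain_at[OF \<sigma>' smooth_on_has_derivative[OF f this]]
    have "(F has_derivative (\<lambda>h. ?A (\<sigma> z) (L h))) (at z)" by (simp add: F_def[abs_def] o_def)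
    from frechet_derivative_at[OF this, symmetric] show ?thesis by (rule fun_cong)
  qed
  have "inj (frechet_derivative F (at 0))"
    unfolding linear_injective_0[OF smooth_on_linear_deriv[OF F S(2)]] dF[OF S(2)] \<sigma>0
  proof (intro allI impI)
    fix z assume z: "?A p0 (L z) = 0"
    \<comment> \<open>The input discrepancy between \<open>L z\<close> and \<open>R (C z)\<close>.
      Since \<open>C z\<close> has no b-components, those of the image of \<open>?\<eta>\<close>
      vanish, which forces \<open>?\<eta> = 0\<close> and then \<open>z = 0\<close>.\<close>
    let ?\<eta> = "P z - snd (R (C z))"
    have "L z = R (C z) + (0, ?\<eta>)" by (simp add: L_def prod_eq_iff)
    then have eq: "C z + ?A p0 (0, ?\<eta>) = 0"
      using z linear_add[OF lin[OF D(2)], of "R (C z)" "(0, ?\<eta>)"] AR by simp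
    have "?A p0 (0, ?\<eta>) $ \<beta> j = 0" for j
      using arg_cong[OF eq, of "\<lambda>v. v $ \<beta> j"] by (simp add: C_def)
    then have \<eta>: "?\<eta> = 0" by (rule \<beta>(2))
    then have "C z = 0" using eq linear_0[OF linV] by simp
    moreover from this have "P z = 0" using \<eta> linear_0[OF R(1)] by simp
    ultimately have "z $ i = 0" for i
      by (cases "i \<in> range \<beta>") (auto simp: C_def P_def vec_eq_iff split: if_splits)
    then show "z = 0" by (simp add: vec_eq_iff)
  qed
  then obtain Z where Z: "0 \<in> Z" "Z \<subseteq> S" "diffeo_on Z F"
    using smooth_inverse_function_theorem[OF S F] by blast
  obtain G where G: "smooth_on (F ` Z) G" "\<And>z. z \<in> Z \<Longrightarrow> G (F z) = z"
    and oZ: "open Z" "open (F ` Z)" "smooth_on Z F"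
    using Z(3) unfolding diffeo_on_def by blast
  let ?W1 = "F ` Z"
  have G_img: "G ` ?W1 = Z" using G(2) by force
  have FG: "F (G y) = y" "G y \<in> Z" if "y \<in> ?W1" for y using that G(2) by auto
  have diffG: "diffeo_on ?W1 G"
    unfolding diffeo_on_def G_img using oZ G FG by blast
  have dG: "frechet_derivative G (at (F z)) (frechet_derivative F (at z) h) = h" if z: "z \<in> Z" for z h
  proof -
    have "F z \<in> F ` Z" using z by blast
    from diff_chain_at[OF smooth_on_has_derivative[OF oZ(3) z] smooth_on_has_derivative[OF G(1) this]]
    have "((\<lambda>z. G (F z)) has_derivative
        (\<lambda>h. frechet_derivative G (at (F z)) (frechet_derivative F (at z) h))) (at z)"
      by (simp add: o_def)
    then have "((\<lambda>z. z) has_derivative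
        (\<lambda>h. frechet_derivative G (at (F z)) (frechet_derivative F (at z) h))) (at z)"
      by (rule has_derivative_transform_within_open[OF _ oZ(1) z]) (rule G(2))
    from fun_cong[OF has_derivative_unique[OF this has_derivative_ident], of h] show ?thesis .
  qed
  have x1: "f p0 \<in> ?W1" using Z(1) \<sigma>0 by (force simp: F_def)
  have W1X: "?W1 \<subseteq> X" using Z(2) N(3) X(3) by (auto simp: F_def S_def)
  have Gball: "G ` ?W1 \<subseteq> ball 0 1" unfolding G_img using Z(2) by (auto simp: S_def)
  have x0: "fst p0 \<in> X" using X(2) D(2) by auto
  \<comment> \<open>\<open>G\<close> is available near the shifted state only; \<open>\<phi>\<close>
    acts near \<open>fst p0\<close> as well and still equals \<open>G\<close> on
    \<open>W2\<close>.\<close>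
  obtain W \<phi> W2 where W: "W \<subseteq> X" "diffeo_on W \<phi>" "fst p0 \<in> W" "f p0 \<in> W2" "open W2"
      "W2 \<subseteq> W" "W2 \<subseteq> ?W1" and \<phi>G: "\<forall>y\<in>W2. \<phi> y = G y"
    by (rule diffeo_on_extend_to_point[OF diffG x1 W1X Gball X(1) x0])
  obtain \<psi> where \<psi>: "smooth_on (\<phi> ` W) \<psi>" "\<And>x. x \<in> W \<Longrightarrow> \<psi> (\<phi> x) = x"
    and oW: "open W" "open (\<phi> ` W)" "smooth_on W \<phi>"
    using W(2) unfolding diffeo_on_def by blast
  define D1 where "D1 = (N \<inter> f -` W2) \<inter> fst -` W"
  have fN: "smooth_on N f" using f N(3) by (rule smooth_on_subset)
  have "open (N \<inter> f -` W2)"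
    by (rule continuous_open_preimage[OF smooth_on_continuous[OF fN] N(1) W(5)])
  moreover have "open (fst -` W :: ((real^'n) \<times> (real^'m)) set)" using oW(1) by (rule open_vimage_fst)
  ultimately have D1: "open D1" "p0 \<in> D1" "D1 \<subseteq> D" "D1 \<subseteq> N"
    using N W(3,4) by (auto simp: D1_def)
  have fD1: "smooth_on D1 f" using f D1(3) by (rule smooth_on_subset)
  have f_img: "f ` D1 \<subseteq> W2" and fst_img: "fst ` D1 \<subseteq> W" by (auto simp: D1_def)
  have Gf: "smooth_on D1 (\<lambda>p. G (f p))"
    by (rule smooth_on_compose[OF D1(1) oZ(2) _ fD1 G(1)]) (use f_img W(7) in auto)
  have dGf: "frechet_derivative (\<lambda>p. G (f p)) (at p) h = frechet_derivative G (at (f p)) (?A p h)"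
    if "p \<in> D1" for p h
  proof -
    have "f p \<in> ?W1" using that f_img W(7) by auto
    from diff_chain_at[OF smooth_on_has_derivative[OF fD1 that] smooth_on_has_derivative[OF G(1) this]]
    have "((\<lambda>p. G (f p)) has_derivative (\<lambda>h. frechet_derivative G (at (f p)) (?A p h))) (at p)"
      by (simp add: o_def)
    from frechet_derivative_at[OF this, symmetric] show ?thesis by (rule fun_cong)
  qed
  \<comment> \<open>The points \<open>p\<close> and \<open>\<sigma> (G (f p))\<close> lie in the
    same fibre of \<open>f\<close>, hence have the same input image. At the latter that image
    consists of the b-derivatives of \<open>F\<close>, which \<open>G\<close> straightens to the
    range of \<open>J\<close>.\<close>
  have dGf_input: "\<exists>\<eta>'. frechet_derivative (\<lambda>p. G (f p)) (at p) (0, \<eta>) = J \<eta>'" if p: "p \<in> D1" for p \<eta>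
  proof -
    have y: "f p \<in> ?W1" using p f_img W(7) by auto
    let ?z = "G (f p)"
    have z: "?z \<in> Z" "F ?z = f p" using FG[OF y] by auto
    then have "\<sigma> ?z \<in> N" "f (\<sigma> ?z) = f p" using Z(2) by (auto simp: S_def F_def)
    then obtain \<eta>' where "?A p (0, \<eta>) = ?A (\<sigma> ?z) (0, \<eta>')"
      using fibre[of p "\<sigma> ?z" \<eta>] p D1(4) by (metis subsetD)
    also have "\<dots> = frechet_derivative F (at ?z) (J \<eta>')"
      using dF[of ?z "J \<eta>'"] z(1) Z(2) LJ by auto
    finally have "frechet_derivative (\<lambda>p. G (f p)) (at p) (0, \<eta>) = J \<eta>'"
      using dGf[OF p] dG[OF z(1)] z(2) by simp
    then show ?thesis ..
  qed
  have dGf_p0: "frechet_derivative (\<lambda>p. G (f p)) (at p0) (0, \<eta>) = J \<eta>" for \<eta>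
  proof -
    have "?A p0 (0, \<eta>) = frechet_derivative F (at 0) (J \<eta>)" using dF[OF S(2)] LJ \<sigma>0 by simp
    then show ?thesis using dGf[OF D1(2)] dG[OF Z(1)] \<sigma>0 by (simp add: F_def)
  qed
  \<comment> \<open>The new input is by definition the b-part of the new successor state, so the
    second system equation holds automatically; it remains to see that this is a regular input
    transformation.\<close>
  define \<Phi> where "\<Phi> = (\<lambda>(x, u). (\<phi> x, P (G (f (x, u)))))"
  have \<Phi>_eq: "\<Phi> = (\<lambda>p. (\<phi> (fst p), P (G (f p))))" by (auto simp: \<Phi>_def fun_eq_iff)
  have \<phi>fst: "smooth_on D1 (\<lambda>p. \<phi> (fst p))"
    by (rule smooth_on_compose[OF D1(1) oW(1) fst_img _ oW(3)])
      (rule smooth_on_bounded_linear_compose[OF D1(1) bounded_linear_fst smooth_on_id[OF D1(1)]])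
  have \<Phi>: "smooth_on D1 \<Phi>"
    unfolding \<Phi>_eq by (intro smooth_on_Pair D1(1) \<phi>fst smooth_on_bounded_linear_compose[OF D1(1) blP Gf])
  have d\<Phi>: "frechet_derivative \<Phi> (at p0) h
      = (frechet_derivative \<phi> (at (fst p0)) (fst h), P (frechet_derivative (\<lambda>p. G (f p)) (at p0) h))" for h
  proof -
    have "(fst has_derivative fst) (at p0)"
      by (rule bounded_linear.has_derivative[OF bounded_linear_fst has_derivative_ident])
    from diff_chain_at[OF this smooth_on_has_derivative[OF oW(3) W(3)]]
    have "((\<lambda>p. \<phi> (fst p)) has_derivative (\<lambda>h. frechet_derivative \<phi> (at (fst p0)) (fst h))) (at p0)"
      by (simp add: o_def)
    from has_derivative_Pair[OF this bounded_linear.has_derivative[OF blP smooth_on_has_derivative[OF Gf D1(2)]]]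
    have "(\<Phi> has_derivative (\<lambda>h. (frechet_derivative \<phi> (at (fst p0)) (fst h),
        P (frechet_derivative (\<lambda>p. G (f p)) (at p0) h)))) (at p0)" by (simp add: \<Phi>_eq)
    from frechet_derivative_at[OF this, symmetric] show ?thesis by (rule fun_cong)
  qed
  \<comment> \<open>The derivative is block triangular: the state block is that of
    \<open>\<phi>\<close>, and on inputs \<open>dGf_p0\<close> makes the other block the
    identity.\<close>
  have "inj (frechet_derivative \<Phi> (at p0))"
    unfolding linear_injective_0[OF smooth_on_linear_deriv[OF \<Phi> D1(2)]] d\<Phi>
  proof (intro allI impI)
    fix h
    assume h: "(frechet_derivative \<phi> (at (fst p0)) (fst h), P (frechet_derivative (\<lambda>p. G (f p)) (at p0) h)) = 0"
    then have "frechet_derivative \<phi> (at (fst p0)) (fst h) = frechet_derivative \<phi> (at (fst p0)) 0"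
      using linear_0[OF smooth_on_linear_deriv[OF oW(3) W(3)]] by (simp add: prod_eq_iff)
    then have "fst h = 0" using diffeo_on_inj_deriv[OF W(2,3)] by (meson injD)
    then have h0: "h = (0, snd h)" by (simp add: prod_eq_iff)
    have "P (frechet_derivative (\<lambda>p. G (f p)) (at p0) h) = 0" using h by (simp add: prod_eq_iff)
    then have "P (J (snd h)) = 0" using h0 dGf_p0 by metis
    then show "h = 0" using h0 by (simp add: PJ prod_eq_iff)
  qed
  then obtain U where U: "p0 \<in> U" "U \<subseteq> D1" "diffeo_on U \<Phi>"
    using smooth_inverse_function_theorem[OF D1(1,2) \<Phi>] by blast
  have "open U" using U(3) by (simp add: diffeo_on_def)
  \<comment> \<open>A product neighbourhood with a ball of inputs has convex input slices, and the
    reference input \<open>u0\<close> is admissible for every state in \<open>A\<close>.\<close>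
  then obtain A B' where AB': "open A" "open B'" "p0 \<in> A \<times> B'" "A \<times> B' \<subseteq> U"
    using U(1) by (rule open_prod_elim)
  obtain x0 u0 where p0: "p0 = (x0, u0)" by (cases p0)
  obtain r where r: "r > 0" "ball u0 r \<subseteq> B'" using AB' p0 by (auto elim: openE)
  define B where "B = ball u0 r"
  define D' where "D' = A \<times> B"
  have D'U: "D' \<subseteq> U" using AB'(4) r by (auto simp: D'_def B_def)
  have u0: "u0 \<in> B" using r by (simp add: B_def)
  have oD': "open D'" using AB'(1) by (simp add: D'_def B_def open_Times)
  have p0D': "p0 \<in> D'" using AB'(3) u0 by (simp add: D'_def p0)
  have D'D1: "D' \<subseteq> D1" using D'U U(2) by blast
  \<comment> \<open>By \<open>dGf_input\<close> input variations move only b-components, so an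
    a-component is constant on the convex set \<open>B\<close>.\<close>
  have indep: "G (f (x, u)) $ i = G (f (x, u0)) $ i" if x: "x \<in> A" and u: "u \<in> B" and i: "i \<notin> range \<beta>" for x u i
  proof (rule has_derivative_zero_unique[of B "\<lambda>w. G (f (x, w)) $ i" u u0])
    show "convex B" by (simp add: B_def)
    fix w assume "w \<in> B"
    then have xw: "(x, w) \<in> D1" using x D'D1 by (auto simp: D'_def)
    have "((\<lambda>w. (x, w)) has_derivative (\<lambda>\<eta>. (0, \<eta>))) (at w)"
      by (intro has_derivative_Pair has_derivative_const has_derivative_ident)
    from bounded_linear.has_derivative[OF bounded_linear_vec_nth
        diff_chain_at[OF this smooth_on_has_derivative[OF Gf xw]], of i]
    have "((\<lambda>w. G (f (x, w)) $ i) has_derivative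
        (\<lambda>\<eta>. frechet_derivative (\<lambda>p. G (f p)) (at (x, w)) (0, \<eta>) $ i)) (at w)"
      by (simp add: o_def)
    moreover have "frechet_derivative (\<lambda>p. G (f p)) (at (x, w)) (0, \<eta>) $ i = 0" for \<eta>
      using dGf_input[OF xw, of \<eta>] i by (auto simp: J_def)
    ultimately show "((\<lambda>w. G (f (x, w)) $ i) has_derivative (\<lambda>h. 0)) (at w within B)"
      by (simp add: has_derivative_at_withinI)
  qed (use u u0 in auto)
  \<comment> \<open>The old state is recovered by \<open>\<psi>\<close>, and the input is frozen at
    \<open>u0\<close>; by \<open>indep\<close> this choice does not affect the value.\<close>
  define fa where "fa i a = G (f (\<psi> a, u0)) $ i" for i a
  define g where "g = (\<lambda>(a, b). \<chi> i. if i \<in> range \<beta> then b $ inv \<beta> i else fa i a)"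
  have AW: "A \<subseteq> W" using D'D1 u0 fst_img by (force simp: D'_def)
  have fst\<Phi>: "fst ` \<Phi> ` D' = \<phi> ` A" using u0 by (force simp: \<Phi>_eq D'_def image_iff)
  have o\<phi>A: "open (\<phi> ` A)"
    using diffeo_on_subset[OF W(2) AB'(1) AW] by (simp add: diffeo_on_def)
  have conj: "\<phi> (f (x, u)) = g (\<phi> x, P (G (f (x, u))))" if "(x, u) \<in> D'" for x u
  proof -
    have xu: "x \<in> A" "u \<in> B" "f (x, u) \<in> W2" "x \<in> W"
      using that D'D1 f_img AW by (auto simp: D'_def)
    have "\<phi> (f (x, u)) $ i = g (\<phi> x, P (G (f (x, u)))) $ i" for i
    proof (cases "i \<in> range \<beta>")
      case True
      then show ?thesis using \<phi>G xu(3) \<beta>(1) by (auto simp: g_def P_def)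
    next
      case False
      then show ?thesis
        using \<phi>G xu(3) indep[OF xu(1,2)] \<psi>(2)[OF xu(4)] by (simp add: g_def fa_def)
    qed
    then show ?thesis by (simp add: vec_eq_iff)
  qed
  have fa: "smooth_on (\<phi> ` A) (fa i)" for i
  proof -
    have "smooth_on (\<phi> ` A) (\<lambda>a. (\<psi> a, u0))"
      by (intro smooth_on_Pair o\<phi>A smooth_on_const smooth_on_subset[OF \<psi>(1)]) (use AW in auto)
    moreover have "(\<lambda>a. (\<psi> a, u0)) ` \<phi> ` A \<subseteq> D1"
    proof clarify
      fix x assume "x \<in> A"
      then have "\<psi> (\<phi> x) = x" "(x, u0) \<in> D1" using \<psi>(2) AW D'D1 u0 by (auto simp: D'_def)
      then show "(\<psi> (\<phi> x), u0) \<in> D1" by simp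
    qed
    ultimately have "smooth_on (\<phi> ` A) (\<lambda>a. G (f (\<psi> a, u0)))"
      using smooth_on_compose[OF o\<phi>A D1(1) _ _ Gf, of "\<lambda>a. (\<psi> a, u0)"] by blast
    then show ?thesis
      unfolding fa_def by (rule smooth_on_bounded_linear_compose[OF o\<phi>A bounded_linear_vec_nth])
  qed
  have "decomposed_form (\<Phi> ` D') g"
    unfolding decomposed_form_def fst\<Phi>
  proof (intro exI conjI allI impI)
    show "inj \<beta>" by (rule \<beta>(1))
    show "smooth_on (\<phi> ` A) (fa i)" for i by (rule fa)
    show "\<forall>(x, u)\<in>\<Phi> ` D'. (\<forall>i. i \<notin> range \<beta> \<longrightarrow> g (x, u) $ i = fa i x) \<and> (\<forall>j. g (x, u) $ \<beta> j = u $ j)"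
      using \<beta>(1) by (auto simp: g_def)
  qed
  moreover have "fst ` D' \<subseteq> W" "f ` D' \<subseteq> W" using D'D1 fst_img f_img W(6) by blast+
  ultimately have "transformable_on X D' f decomposed_form"
    unfolding transformable_on_def
    using W(1,2) diffeo_on_subset[OF U(3) oD' D'U] conj
    by (intro exI[of _ W] exI[of _ \<phi>] exI[of _ "\<lambda>p. P (G (f p))"] exI[of _ g] conjI)
      (auto simp: \<Phi>_def)
  with oD' p0D' D'D1 D1(3) show ?thesis by blast
qed

section \<open>From the rank condition to the theorem\<close>

lemma input_derivative_injective:
  fixes f :: "(real^'n) \<times> (real^'m) \<Rightarrow> real^'n"
  assumes "f differentiable (at (x, u))"
    and "rank (matrix (frechet_derivative (\<lambda>w. f (x, w)) (at u))) = CARD('m)"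
    and "frechet_derivative f (at (x, u)) (0, \<eta>) = 0"
  shows "\<eta> = 0"
proof -
  let ?L = "frechet_derivative (\<lambda>w. f (x, w)) (at u)"
  \<comment> \<open>Composing with the inclusion of the input fibre identifies the partial
    derivative in the input with the full derivative on U; full column rank is then
    injectivity.\<close>
  have "((\<lambda>w. (x, w)) has_derivative (\<lambda>\<eta>. (0, \<eta>))) (at u)"
    by (intro has_derivative_Pair has_derivative_const has_derivative_ident)
  from diff_chain_at[OF this assms(1)[unfolded frechet_derivative_works]]
  have der: "((\<lambda>w. f (x, w)) has_derivative (\<lambda>\<eta>. frechet_derivative f (at (x, u)) (0, \<eta>))) (at u)"
    by (simp add: o_def)
  then have lin: "linear ?L"
    using frechet_derivative_at has_derivative_bounded_linear bounded_linear.linear by metis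
  have "?L \<eta> = 0" using fun_cong[OF frechet_derivative_at[OF der], of \<eta>] assms(3) by simp
  then have "matrix ?L *v \<eta> = matrix ?L *v 0" using lin by (simp add: matrix_works linear_0)
  moreover have "inj ((*v) (matrix ?L))" using assms(2) by (simp add: full_rank_injective)
  ultimately show ?thesis by (meson injD)
qed

theorem lemma9:
  fixes X :: "(real^'n) set"
    and E :: "((real^'n) \<times> (real^'m)) set"
    and f :: "(real^'n) \<times> (real^'m) \<Rightarrow> real^'n"
  assumes "open X" and "open E" and "fst ` E = X"
    and smooth: "smooth_on E f"
    and surjective: "f ` E = X"
    and submersion: "\<And>p. p \<in> E \<Longrightarrow> surj (frechet_derivative f (at p))"
    and no_redundant_inputs:
      "\<And>x u. (x, u) \<in> E \<Longrightarrow>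
         rank (matrix (frechet_derivative (\<lambda>w. f (x, w)) (at u))) = CARD('m)"
  shows "(\<forall>D. open D \<and> D \<subseteq> E \<and> transformable_on X D f decomposed_form
              \<longrightarrow> bracket_condition D f) \<and>
         (\<forall>D. open D \<and> D \<subseteq> E \<and> bracket_condition D f
              \<longrightarrow> (\<forall>p\<in>D. \<exists>D'. open D' \<and> p \<in> D' \<and> D' \<subseteq> D \<and>
                                transformable_on X D' f decomposed_form))"
proof -
  have inj: "\<eta> = 0" if "p \<in> E" "frechet_derivative f (at p) (0, \<eta>) = 0" for p \<eta>
  proof (cases p)
    case (Pair x u)
    with that show ?thesis
      using input_derivative_injective[OF smooth_on_differentiable[OF smooth] no_redundant_inputs] by blast
  qed
  show ?thesis
  proof (intro conjI allI impI ballI; elim conjE)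
    fix D assume D: "open D" "D \<subseteq> E" "transformable_on X D f decomposed_form"
    show "bracket_condition D f"
      by (rule bracket_condition_if_transformable[OF D(1) smooth_on_subset[OF smooth D(2)] _ D(3)])
        (use inj D(2) in blast)
  next
    fix D p assume D: "p \<in> D" "open D" "D \<subseteq> E" "bracket_condition D f"
    show "\<exists>D'. open D' \<and> p \<in> D' \<and> D' \<subseteq> D \<and> transformable_on X D' f decomposed_form"
      by (rule transformable_if_bracket_condition[OF D(2,1) smooth_on_subset[OF smooth D(3)] assms(1)
            _ _ _ _ D(4)])
        (use D(1,3) assms(3) surjective submersion inj in blast)+
  qed
qed

end
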